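(* There exists $\varepsilon'>0$ such that for all integers $n$ large enough, $$\mathcal{P}_{1/2}\big(o\to\partial\Lambda_n \text{ without forbidden pattern}\big)\;\le\;\mathcal{P}_{1/2-\varepsilon'}\big(o\to\partial\Lambda_n\big).$$
   Context: $\mathcal{P}_q$ denotes i.i.d. bond percolation on the undirected nearest-neighbor edges of $\mathbb{Z}^2$, each edge being open with probability $q$ and closed otherwise. $o=(0,0)$ and $\partial\Lambda_n=\{z\in\mathbb{Z}^2:\|z\|_\infty=n\}$. The event $\{o\to\partial\Lambda_n\}$ means that $o$ is joined to $\partial\Lambda_n$ by an open path. Forbidden patterns: the first forbidden pattern consists of the five edges $\{(0,0),(0,1)\}$, $\{(0,1),(1,1)\}$, $\{(1,0),(1,1)\}$, $\{(1,0),(2,0)\}$, $\{(2,0),(2,1)\}$ being open and the two edges $\{(0,0),(1,0)\}$, $\{(1,1),(2,1)\}$ being closed. The second forbidden pattern is obtained by rotating the first one counter-clockwise by the angle $\pi/2$ around the origin. The set of forbidden patterns consists of all translates by elements of $\mathbb{Z}^2$ of these two patterns. A path uses a forbidden pattern if this pattern occurs in the configuration (its five edges are open and its two edges are closed, as specified) and the path contains all five open edges of the pattern. The event $\{o\to\partial\Lambda_n\text{ without forbidden pattern}\}$ means that $o$ is joined to $\partial\Lambda_n$ by an open path using none of the forbidden patterns (forbidden patterns may occur in the configuration, and a path may use some of the individual edges of a pattern). *)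

theory Defs
  imports "HOL-Probability.Probability"
begin

type_synonym vertex = "int \<times> int"
type_synonym edge = "vertex set"

definition lattice_edges :: "edge set" where
  "lattice_edges = {{u, v} | u v. \<bar>fst u - fst v\<bar> + \<bar>snd u - snd v\<bar> = 1}"

text \<open>A configuration maps an edge to True iff the edge is open; it is undefined
  outside of \<open>lattice_edges\<close>.\<close>

definition percolation :: "real \<Rightarrow> (edge \<Rightarrow> bool) measure" where
  "percolation q = (\<Pi>\<^sub>M e\<in>lattice_edges. measure_pmf (bernoulli_pmf q))"

definition box_boundary :: "nat \<Rightarrow> vertex set" where
  "box_boundary n = {z. max \<bar>fst z\<bar> \<bar>snd z\<bar> = int n}"

definition path_edges :: "vertex list \<Rightarrow> edge set" where
  "path_edges p = {{p ! i, p ! Suc i} | i. Suc i < length p}"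

definition open_path :: "(edge \<Rightarrow> bool) \<Rightarrow> vertex list \<Rightarrow> bool" where
  "open_path \<omega> p \<longleftrightarrow> p \<noteq> [] \<and> distinct p \<and> (\<forall>e\<in>path_edges p. e \<in> lattice_edges \<and> \<omega> e)"

text \<open>A pattern is a pair: the edges required to be open, and the edges required to be closed.\<close>

type_synonym pattern = "edge set \<times> edge set"

definition first_pattern :: pattern where
  "first_pattern =
    ({{(0,0),(0,1)}, {(0,1),(1,1)}, {(1,0),(1,1)}, {(1,0),(2,0)}, {(2,0),(2,1)}},
     {{(0,0),(1,0)}, {(1,1),(2,1)}})"

definition map_pattern :: "(vertex \<Rightarrow> vertex) \<Rightarrow> pattern \<Rightarrow> pattern" where
  "map_pattern f \<pi> = ((`) f ` fst \<pi>, (`) f ` snd \<pi>)"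

definition rotate_ccw :: "vertex \<Rightarrow> vertex" where
  "rotate_ccw z = (- snd z, fst z)"

definition second_pattern :: pattern where
  "second_pattern = map_pattern rotate_ccw first_pattern"

definition forbidden_patterns :: "pattern set" where
  "forbidden_patterns =
    {map_pattern (\<lambda>z. z + v) \<pi> | v \<pi>. \<pi> \<in> {first_pattern, second_pattern}}"

definition occurs :: "pattern \<Rightarrow> (edge \<Rightarrow> bool) \<Rightarrow> bool" where
  "occurs \<pi> \<omega> \<longleftrightarrow> (\<forall>e\<in>fst \<pi>. \<omega> e) \<and> (\<forall>e\<in>snd \<pi>. \<not> \<omega> e)"

definition uses_pattern :: "(edge \<Rightarrow> bool) \<Rightarrow> vertex list \<Rightarrow> pattern \<Rightarrow> bool" where
  "uses_pattern \<omega> p \<pi> \<longleftrightarrow> occurs \<pi> \<omega> \<and> fst \<pi> \<subseteq> path_edges p"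

definition origin_to_boundary :: "real \<Rightarrow> nat \<Rightarrow> (edge \<Rightarrow> bool) set" where
  "origin_to_boundary q n = {\<omega> \<in> space (percolation q).
     \<exists>p. open_path \<omega> p \<and> hd p = (0,0) \<and> last p \<in> box_boundary n}"

definition origin_to_boundary_without_forbidden :: "real \<Rightarrow> nat \<Rightarrow> (edge \<Rightarrow> bool) set" where
  "origin_to_boundary_without_forbidden q n = {\<omega> \<in> space (percolation q).
     \<exists>p. open_path \<omega> p \<and> hd p = (0,0) \<and> last p \<in> box_boundary n \<and>
         (\<forall>\<pi>\<in>forbidden_patterns. \<not> uses_pattern \<omega> p \<pi>)}"

text \<open>Both events are measurable, so their \<open>measure\<close> is their actual probability and not
  the default value 0.\<close>

lemma forbidden_pattern_edges:
  assumes "\<pi> \<in> forbidden_patterns"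
  shows "fst \<pi> \<subseteq> lattice_edges" "snd \<pi> \<subseteq> lattice_edges"
    and "finite (fst \<pi>)" "finite (snd \<pi>)"
proof -
  have E: "{u, v} \<in> lattice_edges" if "\<bar>fst u - fst v\<bar> + \<bar>snd u - snd v\<bar> = 1" for u v
    using that unfolding lattice_edges_def by blast
  from assms show "fst \<pi> \<subseteq> lattice_edges" "snd \<pi> \<subseteq> lattice_edges"
    and "finite (fst \<pi>)" "finite (snd \<pi>)"
    by (auto simp: forbidden_patterns_def second_pattern_def first_pattern_def map_pattern_def
          rotate_ccw_def intro!: E)
qed

lemma countable_forbidden_patterns: "countable forbidden_patterns"
proof -
  have "forbidden_patterns =
      (\<Union>\<pi>\<in>{first_pattern, second_pattern}. range (\<lambda>v. map_pattern (\<lambda>z. z + v) \<pi>))"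
    unfolding forbidden_patterns_def by blast
  also have "countable \<dots>"
    by (intro countable_UN countable_finite countable_image countableI_type) auto
  finally show ?thesis .
qed

lemma finite_path_edges: "finite (path_edges p)"
proof -
  have "path_edges p = (\<lambda>i. {p ! i, p ! Suc i}) ` {i. Suc i < length p}"
    unfolding path_edges_def by auto
  moreover have "finite {i. Suc i < length p}"
    by (rule finite_subset[of _ "{..<length p}"]) auto
  ultimately show ?thesis by simp
qed

lemma pred_edge_open:
  assumes "e \<in> lattice_edges"
  shows "Measurable.pred (percolation q) (\<lambda>\<omega>. \<omega> e)"
  using assms unfolding percolation_def by measurable

lemma pred_open_path: "Measurable.pred (percolation q) (\<lambda>\<omega>. open_path \<omega> p)"
proof -
  have "Measurable.pred (percolation q) (\<lambda>\<omega>. \<forall>e\<in>path_edges p. e \<in> lattice_edges \<and> \<omega> e)"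
  proof (cases "path_edges p \<subseteq> lattice_edges")
    case True
    have "Measurable.pred (percolation q) (\<lambda>\<omega>. \<forall>e\<in>path_edges p. \<omega> e)"
      using True by (intro pred_intros_finite finite_path_edges pred_edge_open) auto
    also have "(\<lambda>\<omega>. \<forall>e\<in>path_edges p. \<omega> e) = (\<lambda>\<omega>. \<forall>e\<in>path_edges p. e \<in> lattice_edges \<and> \<omega> e)"
      using True by (intro ext) auto
    finally show ?thesis .
  next
    case False
    then have "(\<lambda>\<omega>. \<forall>e\<in>path_edges p. e \<in> lattice_edges \<and> \<omega> e) = (\<lambda>\<omega>. False)"
      by (intro ext) auto
    then show ?thesis by simp
  qed
  then show ?thesis unfolding open_path_def by measurable
qed

lemma pred_uses_pattern:
  assumes "\<pi> \<in> forbidden_patterns"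
  shows "Measurable.pred (percolation q) (\<lambda>\<omega>. uses_pattern \<omega> p \<pi>)"
  unfolding uses_pattern_def occurs_def
  using forbidden_pattern_edges[OF assms]
  by (intro pred_intros_logic pred_intros_finite pred_edge_open) auto

lemma origin_to_boundary_sets: "origin_to_boundary q n \<in> sets (percolation q)"
  unfolding origin_to_boundary_def pred_def[symmetric]
  by (intro pred_intros_countable pred_intros_logic pred_open_path) auto

lemma origin_to_boundary_without_forbidden_sets:
  "origin_to_boundary_without_forbidden q n \<in> sets (percolation q)"
proof -
  have "Measurable.pred (percolation q) (\<lambda>\<omega>. \<forall>\<pi>\<in>forbidden_patterns. \<not> uses_pattern \<omega> p \<pi>)" for p
    unfolding pred_def
    by (intro sets.sets_Collect_countable_All' countable_forbidden_patterns)
      (auto simp: pred_def[symmetric] intro!: pred_intros_logic pred_uses_pattern)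
  then show ?thesis
    unfolding origin_to_boundary_without_forbidden_def pred_def[symmetric]
    by (intro pred_intros_countable pred_intros_logic pred_open_path) auto
qed

end

theory Submission
  imports Defs
begin

text \<open>The argument is that of Aizenman and Grimmett. Keep only the first pattern, at the points
  of a sparse grid, and give each of these points a switch that permits its pattern. The event
  that the origin reaches the target by a path using no pattern whose switch is off is increasing
  in the edges and in the switches jointly: opening an edge never spoils a path. Whenever an edge
  is pivotal, a change of the configuration inside a rectangle of bounded size makes the switch of
  the only grid pattern in that rectangle pivotal: take a path of the event, close all edges of
  the rectangle, and reconnect the first entrance and the last exit of the path by a detour
  through the pattern. Hence the density of one edge can be lowered by a fixed small amount if
  one switch is raised by a fixed amount, without decreasing the probability. After this has
  been done for all edges, forgetting the switches leaves ordinary percolation at a density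
  below \<open>1/2\<close>.\<close>

section \<open>Finite products of Bernoulli variables\<close>

text \<open>Two demands shape the argument: the density step must not depend on \<open>n\<close>,
  and the switches start at probability 0. Because of the second, a local change that altered a
  switch could cost an unbounded factor in probability; hence the surgery alters only edges, whose
  densities stay in [1/4, 1/2] throughout. The first is met because regions have bounded size and
  each switch is charged by boundedly many edges, so that its charges sum to at most 1. Coordinates
  are moved one at a time: the probability is affine in each of them, so Russo's formula becomes an
  exact difference identity and no derivative is taken. The geometric obstacle is that every edge
  needs a region that avoids both the origin and the target, even next to either of them, where
  there is little room to divert a path. Stopping paths at their first visit to the target removes
  the one case in which diversion is impossible.\<close>

definition bern_weight :: "'i set \<Rightarrow> ('i \<Rightarrow> real) \<Rightarrow> 'i set \<Rightarrow> real" where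
  "bern_weight I p S = (\<Prod>i\<in>I. if i \<in> S then p i else 1 - p i)"

definition bern_prob :: "'i set \<Rightarrow> ('i \<Rightarrow> real) \<Rightarrow> ('i set \<Rightarrow> bool) \<Rightarrow> real" where
  "bern_prob I p A = (\<Sum>S\<in>Pow I. if A S then bern_weight I p S else 0)"

text \<open>Inserting and removing \<open>i\<close> explicitly makes pivotality independent of
  whether \<open>i\<close> lies in \<open>S\<close>, so its probability does not depend on
  \<open>p i\<close>.\<close>

definition pivotal :: "'i \<Rightarrow> ('i set \<Rightarrow> bool) \<Rightarrow> 'i set \<Rightarrow> bool" where
  "pivotal i A S \<longleftrightarrow> A (insert i S) \<and> \<not> A (S - {i})"

lemma bern_weight_nonneg:
  assumes "\<And>i. i \<in> I \<Longrightarrow> 0 \<le> p i \<and> p i \<le> 1"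
  shows "0 \<le> bern_weight I p S"
  using assms by (auto simp: bern_weight_def intro!: prod_nonneg)

lemma bern_prob_nonneg:
  assumes "\<And>i. i \<in> I \<Longrightarrow> 0 \<le> p i \<and> p i \<le> 1"
  shows "0 \<le> bern_prob I p A"
  unfolding bern_prob_def using bern_weight_nonneg[OF assms] by (auto intro!: sum_nonneg)

lemma bern_prob_mono:
  assumes "\<And>i. i \<in> I \<Longrightarrow> 0 \<le> p i \<and> p i \<le> 1"
    and "\<And>S. S \<subseteq> I \<Longrightarrow> A S \<Longrightarrow> B S"
  shows "bern_prob I p A \<le> bern_prob I p B"
  unfolding bern_prob_def using bern_weight_nonneg[OF assms(1)] assms(2)
  by (auto intro!: sum_mono)

lemma bern_prob_cong:
  assumes "\<And>i. i \<in> I \<Longrightarrow> p i = q i" and "\<And>S. S \<subseteq> I \<Longrightarrow> A S = B S"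
  shows "bern_prob I p A = bern_prob I q B"
  unfolding bern_prob_def bern_weight_def using assms
  by (intro sum.cong refl if_cong prod.cong) auto

lemma bern_prob_insert:
  assumes "finite I" "i \<notin> I"
  shows "bern_prob (insert i I) p A =
    p i * bern_prob I p (\<lambda>S. A (insert i S)) + (1 - p i) * bern_prob I p A"
proof -
  have w1: "bern_weight (insert i I) p S = (1 - p i) * bern_weight I p S" if "S \<in> Pow I" for S
    using assms that by (auto simp: bern_weight_def)
  have w2: "bern_weight (insert i I) p (insert i S) = p i * bern_weight I p S" if "S \<in> Pow I" for S
  proof -
    have "(\<Prod>j\<in>I. if j \<in> insert i S then p j else 1 - p j) = (\<Prod>j\<in>I. if j \<in> S then p j else 1 - p j)"
      using assms by (intro prod.cong) auto
    then show ?thesis using assms by (simp add: bern_weight_def)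
  qed
  have inj: "inj_on (insert i) (Pow I)"
    using assms(2) by (auto simp: inj_on_def)
  have "bern_prob (insert i I) p A =
      (\<Sum>S\<in>Pow I. if A S then bern_weight (insert i I) p S else 0)
    + (\<Sum>S\<in>insert i ` Pow I. if A S then bern_weight (insert i I) p S else 0)"
    unfolding bern_prob_def Pow_insert using assms
    by (intro sum.union_disjoint) auto
  also have "(\<Sum>S\<in>insert i ` Pow I. if A S then bern_weight (insert i I) p S else 0)
     = (\<Sum>S\<in>Pow I. if A (insert i S) then bern_weight (insert i I) p (insert i S) else 0)"
    by (subst sum.reindex[OF inj]) simp
  also have "\<dots> = (\<Sum>S\<in>Pow I. p i * (if A (insert i S) then bern_weight I p S else 0))"
    by (intro sum.cong refl) (simp add: w2)
  also have "(\<Sum>S\<in>Pow I. if A S then bern_weight (insert i I) p S else 0)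
     = (\<Sum>S\<in>Pow I. (1 - p i) * (if A S then bern_weight I p S else 0))"
    by (intro sum.cong refl) (simp add: w1)
  finally show ?thesis by (simp add: bern_prob_def sum_distrib_left)
qed

lemma bern_prob_Un_irrelevant:
  assumes "finite J" "finite I" "I \<inter> J = {}" and "\<And>S. A S = A (S - J)"
  shows "bern_prob (I \<union> J) p A = bern_prob I p A"
  using assms(1,3,4)
proof (induction J rule: finite_induct)
  case (insert j J)
  note A = insert.prems(2)
  have "(S - J) - insert j J = S - insert j J" for S
    by auto
  then have "A S = A (S - J)" for S
    using A[of S] A[of "S - J"] by simp
  then have IH: "bern_prob (I \<union> J) p A = bern_prob I p A"
    using insert by blast
  have "A (insert j S) = A S" for S
    using A[of S] A[of "insert j S"] by simp
  then have "bern_prob (insert j (I \<union> J)) p A = bern_prob (I \<union> J) p A"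
    by (subst bern_prob_insert) (use insert assms(2) in \<open>auto simp: algebra_simps\<close>)
  with IH show ?case by simp
qed simp

lemma bern_prob_Un_zero:
  assumes "finite J" "finite I" "I \<inter> J = {}" and "\<And>j. j \<in> J \<Longrightarrow> p j = 0"
  shows "bern_prob (I \<union> J) p A = bern_prob I p A"
  using assms(1,3,4)
proof (induction J rule: finite_induct)
  case (insert j J)
  have "bern_prob (insert j (I \<union> J)) p A = bern_prob (I \<union> J) p A"
    by (subst bern_prob_insert) (use insert assms(2) in auto)
  then show ?case using insert by simp
qed simp

text \<open>Russo's formula without a derivative: given the other coordinates the probability is
  affine in \<open>p i\<close>, and by monotonicity its slope is the probability that
  \<open>i\<close> is pivotal.\<close>

lemma bern_prob_update:
  assumes fin: "finite I" and i: "i \<in> I" and mono: "\<And>S T. S \<subseteq> T \<Longrightarrow> A S \<Longrightarrow> A T"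
  shows "bern_prob I (p(i := q)) A = bern_prob I p A + (q - p i) * bern_prob I p (pivotal i A)"
proof -
  define J where "J = I - {i}"
  have I: "I = insert i J" "finite J" "i \<notin> J"
    using fin i by (auto simp: J_def)
  have c: "bern_prob J (p(i := q)) B = bern_prob J p B" for B
    using I by (intro bern_prob_cong) auto
  have piv_insert: "bern_prob J p (\<lambda>S. pivotal i A (insert i S)) = bern_prob J p (pivotal i A)"
    using I by (intro bern_prob_cong) (auto simp: pivotal_def)
  have piv: "bern_prob J p (pivotal i A) = bern_prob J p (\<lambda>S. A (insert i S)) - bern_prob J p A"
    unfolding bern_prob_def sum_subtractf[symmetric]
  proof (intro sum.cong refl)
    fix S assume "S \<in> Pow J"
    then have "S - {i} = S" using I by auto
    moreover have "A S \<Longrightarrow> A (insert i S)" using mono[of S "insert i S"] by auto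
    ultimately show "(if pivotal i A S then bern_weight J p S else 0) =
       (if A (insert i S) then bern_weight J p S else 0) - (if A S then bern_weight J p S else 0)"
      by (auto simp: pivotal_def)
  qed
  show ?thesis
    unfolding I(1) bern_prob_insert[OF I(2,3)] c fun_upd_same piv_insert piv
    by (simp add: algebra_simps)
qed

text \<open>The factors off \<open>G\<close> agree. Those on \<open>G\<close> contribute at least
  \<open>\<kappa> ^ card G\<close> to the weight of \<open>T\<close> and at most 1 to that of
  \<open>S\<close>.\<close>

lemma bern_weight_local_change:
  assumes fin: "finite I" and G: "G \<subseteq> I"
    and p: "\<And>i. i \<in> I \<Longrightarrow> 0 \<le> p i \<and> p i \<le> 1"
    and \<kappa>: "0 < \<kappa>" "\<And>g. g \<in> G \<Longrightarrow> \<kappa> \<le> p g \<and> p g \<le> 1 - \<kappa>"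
    and ST: "S - G = T - G"
  shows "\<kappa> ^ card G * bern_weight I p S \<le> bern_weight I p T"
proof -
  have finG: "finite G" using G fin finite_subset by blast
  have split: "bern_weight I p S = bern_weight (I - G) p S * bern_weight G p S" for S
    unfolding bern_weight_def using prod.subset_diff[OF G fin] by blast
  have eq: "bern_weight (I - G) p S = bern_weight (I - G) p T"
    unfolding bern_weight_def using ST by (intro prod.cong) auto
  have "(\<Prod>g\<in>G. \<kappa>) \<le> bern_weight G p T"
    unfolding bern_weight_def using \<kappa>(1) by (intro prod_mono) (use \<kappa>(2) in force)
  then have lo: "\<kappa> ^ card G \<le> bern_weight G p T" by simp
  have hi: "bern_weight G p S \<le> 1"
    unfolding bern_weight_def using p G by (intro prod_le_1) auto
  have nn: "0 \<le> bern_weight (I - G) p T" "0 \<le> bern_weight G p S"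
    using p G by (auto intro!: bern_weight_nonneg)
  have "\<kappa> ^ card G * bern_weight G p S \<le> bern_weight G p T"
    using mult_left_mono[OF hi, of "\<kappa> ^ card G"] \<kappa>(1) lo by (simp add: order_trans[OF _ lo])
  then show ?thesis
    using mult_left_mono[OF _ nn(1)] unfolding split[of S] split[of T] eq
    by (metis mult.left_commute)
qed

lemma card_agreeing_off_le:
  assumes "finite G"
  shows "card {S \<in> Pow I. S - G = U - G} \<le> 2 ^ card G"
proof -
  have "inj_on (\<lambda>S. S \<inter> G) {S \<in> Pow I. S - G = U - G}"
    by (rule inj_onI) blast
  then have "card {S \<in> Pow I. S - G = U - G} \<le> card (Pow G)"
    by (rule card_inj_on_le) (use assms in auto)
  then show ?thesis by (simp add: card_Pow assms)
qed

text \<open>Moving from \<open>S\<close> to \<open>T\<close> costs a factor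
  \<open>\<kappa> ^ card G\<close>, and each \<open>T\<close> is reached from at most
  \<open>2 ^ card G\<close> configurations; this is the origin of \<open>\<kappa> / 2\<close>. No
  image is chosen: summing over all admissible \<open>T\<close> lets the two sums be
  swapped.\<close>

lemma bern_prob_local_change:
  assumes fin: "finite I" and G: "G \<subseteq> I"
    and p: "\<And>i. i \<in> I \<Longrightarrow> 0 \<le> p i \<and> p i \<le> 1"
    and \<kappa>: "0 < \<kappa>" "\<And>g. g \<in> G \<Longrightarrow> \<kappa> \<le> p g \<and> p g \<le> 1 - \<kappa>"
    and change: "\<And>S. S \<subseteq> I \<Longrightarrow> A S \<Longrightarrow> \<exists>T\<subseteq>I. T - G = S - G \<and> B T"
  shows "(\<kappa> / 2) ^ card G * bern_prob I p A \<le> bern_prob I p B"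
proof -
  let ?w = "bern_weight I p"
  have finG: "finite G" using G fin finite_subset by blast
  have nn: "0 \<le> ?w S" for S using p by (rule bern_weight_nonneg)
  have "\<kappa> ^ card G * bern_prob I p A = (\<Sum>S\<in>Pow I. if A S then \<kappa> ^ card G * ?w S else 0)"
    unfolding bern_prob_def sum_distrib_left by (intro sum.cong) auto
  also have "\<dots> \<le> (\<Sum>S\<in>Pow I. \<Sum>T\<in>Pow I. if B T \<and> S - G = T - G then ?w T else 0)"
  proof (intro sum_mono)
    fix S assume S: "S \<in> Pow I"
    show "(if A S then \<kappa> ^ card G * ?w S else 0)
        \<le> (\<Sum>T\<in>Pow I. if B T \<and> S - G = T - G then ?w T else 0)"
    proof (cases "A S")
      case True
      then obtain T where T: "T \<subseteq> I" "T - G = S - G" "B T" using change[OF _ True] S by auto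
      have "\<kappa> ^ card G * ?w S \<le> ?w T"
        using bern_weight_local_change[OF fin G, of p \<kappa> S T] p \<kappa> T by auto
      also have "\<dots> = (if B T \<and> S - G = T - G then ?w T else 0)" using T by simp
      also have "\<dots> \<le> (\<Sum>T\<in>Pow I. if B T \<and> S - G = T - G then ?w T else 0)"
        by (rule member_le_sum) (use T fin nn in auto)
      finally show ?thesis using True by simp
    next
      case False
      then show ?thesis by (simp add: sum_nonneg nn)
    qed
  qed
  also have "\<dots> = (\<Sum>T\<in>Pow I. \<Sum>S\<in>Pow I. if B T \<and> S - G = T - G then ?w T else 0)"
    by (rule sum.swap)
  also have "\<dots> = (\<Sum>T\<in>Pow I. if B T then card {S \<in> Pow I. S - G = T - G} * ?w T else 0)"
  proof (intro sum.cong refl)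
    fix T
    show "(\<Sum>S\<in>Pow I. if B T \<and> S - G = T - G then ?w T else 0)
      = (if B T then card {S \<in> Pow I. S - G = T - G} * ?w T else 0)"
      using fin by (cases "B T") (simp_all add: sum.inter_filter[symmetric])
  qed
  also have "\<dots> \<le> (\<Sum>T\<in>Pow I. 2 ^ card G * (if B T then ?w T else 0))"
  proof (intro sum_mono)
    fix T
    have "real (card {S \<in> Pow I. S - G = T - G}) \<le> 2 ^ card G"
      using card_agreeing_off_le[OF finG, of I T] by (metis of_nat_le_iff of_nat_numeral of_nat_power)
    from mult_right_mono[OF this nn]
    show "(if B T then card {S \<in> Pow I. S - G = T - G} * ?w T else 0)
        \<le> 2 ^ card G * (if B T then ?w T else 0)" by auto
  qed
  also have "\<dots> = 2 ^ card G * bern_prob I p B"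
    by (simp only: bern_prob_def sum_distrib_left)
  finally show ?thesis by (simp add: power_divide field_simps)
qed

text \<open>Raising \<open>f\<close> gains \<open>d'\<close> times the probability that
  \<open>f\<close> is pivotal, lowering \<open>e\<close> loses \<open>d\<close> times that of
  \<open>e\<close>, and the local change compares the two. \<open>f\<close> stays outside
  \<open>G\<close> because nothing keeps \<open>p f\<close> away from 0 or 1.\<close>

lemma bern_prob_exchange:
  assumes fin: "finite I" and ef: "e \<in> I" "f \<in> I" "e \<noteq> f" and G: "G \<subseteq> I" "f \<notin> G" "card G \<le> M"
    and mono: "\<And>S T. S \<subseteq> T \<Longrightarrow> A S \<Longrightarrow> A T"
    and p: "\<And>i. i \<in> I \<Longrightarrow> 0 \<le> p i \<and> p i \<le> 1"
    and \<kappa>: "0 < \<kappa>" "\<kappa> \<le> 1" "\<And>g. g \<in> G \<Longrightarrow> \<kappa> \<le> p g \<and> p g \<le> 1 - \<kappa>"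
    and d: "0 \<le> d'" "p f + d' \<le> 1" "0 \<le> d" "d \<le> d' * (\<kappa> / 2) ^ M"
    and change: "\<And>S. S \<subseteq> I \<Longrightarrow> pivotal e A S \<Longrightarrow> \<exists>T\<subseteq>I. T - G = S - G \<and> pivotal f A T"
  shows "bern_prob I p A \<le> bern_prob I (p(f := p f + d', e := p e - d)) A"
proof -
  \<comment> \<open>Both pivotality probabilities are taken at the intermediate point, after the
    raise and before the lowering, so that a single comparison serves both identities.\<close>
  define r where "r = p(f := p f + d')"
  have r: "0 \<le> r i \<and> r i \<le> 1" if "i \<in> I" for i
    using p[OF that] p[OF ef(2)] d by (auto simp: r_def)
  have nnf: "0 \<le> bern_prob I r (pivotal f A)" and nne: "0 \<le> bern_prob I r (pivotal e A)"
    using r by (auto intro!: bern_prob_nonneg)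
  have "p = r(f := p f)" by (auto simp: r_def)
  then have "bern_prob I p A = bern_prob I r A + (p f - r f) * bern_prob I r (pivotal f A)"
    using bern_prob_update[OF fin ef(2), of A r "p f"] mono by simp
  then have 1: "bern_prob I p A = bern_prob I r A - d' * bern_prob I r (pivotal f A)"
    by (simp add: r_def)
  have 2: "bern_prob I (r(e := p e - d)) A = bern_prob I r A - d * bern_prob I r (pivotal e A)"
    using bern_prob_update[OF fin ef(1), of A r "p e - d"] mono ef(3) by (simp add: r_def)
  have "(\<kappa> / 2) ^ card G * bern_prob I r (pivotal e A) \<le> bern_prob I r (pivotal f A)"
    by (rule bern_prob_local_change[OF fin G(1) r \<kappa>(1) _ change])
      (use \<kappa>(3) G(2) in \<open>auto simp: r_def\<close>)
  moreover have "(\<kappa> / 2) ^ M \<le> (\<kappa> / 2) ^ card G"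
    using G(3) \<kappa> by (intro power_decreasing) auto
  ultimately have "(\<kappa> / 2) ^ M * bern_prob I r (pivotal e A) \<le> bern_prob I r (pivotal f A)"
    using mult_right_mono[OF _ nne] by fastforce
  from mult_left_mono[OF this d(1)] mult_right_mono[OF d(4) nne]
  have "d * bern_prob I r (pivotal e A) \<le> d' * bern_prob I r (pivotal f A)"
    by (simp add: mult.assoc)
  with 1 2 show ?thesis by (simp add: r_def)
qed

lemma bern_prob_image:
  assumes inj: "inj_on f I"
  shows "bern_prob (f ` I) p A = bern_prob I (p \<circ> f) (\<lambda>S. A (f ` S))"
proof -
  have w: "bern_weight (f ` I) p (f ` S) = bern_weight I (p \<circ> f) S" if "S \<subseteq> I" for S
    unfolding bern_weight_def using inj that
    by (subst prod.reindex) (auto intro!: prod.cong simp: inj_on_image_mem_iff)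
  have "bern_prob (f ` I) p A = (\<Sum>S\<in>(`) f ` Pow I. if A S then bern_weight (f ` I) p S else 0)"
    by (simp add: bern_prob_def image_Pow_surj)
  also have "\<dots> = (\<Sum>S\<in>Pow I. if A (f ` S) then bern_weight (f ` I) p (f ` S) else 0)"
    using inj_on_image_Pow[OF inj] by (subst sum.reindex) simp_all
  also have "\<dots> = bern_prob I (p \<circ> f) (\<lambda>S. A (f ` S))"
    unfolding bern_prob_def by (intro sum.cong refl) (simp add: w)
  finally show ?thesis .
qed

section \<open>From finite products to percolation events on finitely many edges\<close>

lemma measure_percolation_cylinder:
  assumes q: "0 \<le> q" "q \<le> 1" and E: "finite E" "E \<subseteq> lattice_edges"
    and eq: "A = {\<omega> \<in> space (percolation q). B {e \<in> E. \<omega> e}}"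
  shows "A \<in> sets (percolation q)" and "measure (percolation q) A = bern_prob E (\<lambda>_. q) B"
proof -
  interpret product_prob_space "\<lambda>_::edge. measure_pmf (bernoulli_pmf q)" lattice_edges
    by (intro product_prob_spaceI) (rule prob_space_measure_pmf)
  \<comment> \<open>\<open>C S\<close> prescribes the state of every edge of \<open>E\<close>; the
    event is a finite disjoint union of such elementary cylinders.\<close>
  define C where "C S = prod_emb lattice_edges (\<lambda>_. measure_pmf (bernoulli_pmf q)) E (\<Pi>\<^sub>E e\<in>E. {e \<in> S})" for S :: "edge set"
  have memC: "\<omega> \<in> C S \<longleftrightarrow> \<omega> \<in> space (percolation q) \<and> (\<forall>e\<in>E. \<omega> e \<longleftrightarrow> e \<in> S)" for \<omega> S
    using E by (auto simp: C_def prod_emb_def percolation_def space_PiM PiE_iff)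
  have mC: "measure (percolation q) (C S) = bern_weight E (\<lambda>_. q) S" for S
  proof -
    have "measure (percolation q) (C S) = (\<Prod>e\<in>E. measure (bernoulli_pmf q) {e \<in> S})"
      unfolding C_def percolation_def using E by (intro measure_PiM_emb) auto
    also have "\<dots> = bern_weight E (\<lambda>_. q) S"
      unfolding bern_weight_def using q
      by (intro prod.cong refl) (auto simp: measure_pmf_single)
    finally show ?thesis .
  qed
  have setsC: "C S \<in> sets (percolation q)" for S
    unfolding C_def percolation_def using E by (intro sets_PiM_I) auto
  have fin: "finite {S \<in> Pow E. B S}" using E by auto
  have "A = (\<Union>S\<in>{S \<in> Pow E. B S}. C S)"
  proof -
    have "\<omega> \<in> C S \<longleftrightarrow> \<omega> \<in> space (percolation q) \<and> S = {e \<in> E. \<omega> e}" if "S \<in> Pow E" for \<omega> S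
      using that by (auto simp: memC)
    then show ?thesis unfolding eq by auto
  qed
  note A = this
  show "A \<in> sets (percolation q)"
    unfolding A using fin setsC by auto
  have "measure (percolation q) A = (\<Sum>S\<in>{S \<in> Pow E. B S}. measure (percolation q) (C S))"
  proof -
    have "disjoint_family_on C {S \<in> Pow E. B S}"
      unfolding disjoint_family_on_def by (auto simp: memC)
    moreover have "C ` {S \<in> Pow E. B S} \<subseteq> sets (percolation q)" using setsC by auto
    ultimately show ?thesis
      using P.finite_measure_finite_Union[OF fin, of C] A
      by (simp add: percolation_def)
  qed
  also have "\<dots> = bern_prob E (\<lambda>_. q) B"
    using E by (simp only: mC bern_prob_def sum.inter_filter finite_Pow_iff)
  finally show "measure (percolation q) A = bern_prob E (\<lambda>_. q) B" .
qed

section \<open>A path through the pattern in a rectangle\<close>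

definition adj :: "vertex \<Rightarrow> vertex \<Rightarrow> bool" where
  "adj u v \<longleftrightarrow> \<bar>fst u - fst v\<bar> + \<bar>snd u - snd v\<bar> = 1"

lemma adj_sym: "adj u v \<longleftrightarrow> adj v u"
  by (auto simp: adj_def abs_minus_commute)

lemma adj_Pair [simp]: "adj (a, b) (c, d) \<longleftrightarrow> \<bar>a - c\<bar> + \<bar>b - d\<bar> = 1"
  by (simp add: adj_def)

lemma lattice_edge_iff [simp]: "{u, v} \<in> lattice_edges \<longleftrightarrow> adj u v"
proof
  assume "{u, v} \<in> lattice_edges"
  then show "adj u v"
    by (auto simp: lattice_edges_def adj_def doubleton_eq_iff abs_minus_commute)
next
  assume "adj u v"
  then show "{u, v} \<in> lattice_edges"
    unfolding lattice_edges_def adj_def by blast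
qed

lemma path_edges_Nil [simp]: "path_edges [] = {}"
  and path_edges_single [simp]: "path_edges [x] = {}"
  by (auto simp: path_edges_def)

lemma path_edges_Cons [simp]:
  "path_edges (x # y # xs) = insert {x, y} (path_edges (y # xs))"
proof -
  have "e \<in> path_edges (x # y # xs) \<longleftrightarrow> e \<in> insert {x, y} (path_edges (y # xs))" for e
  proof
    assume "e \<in> path_edges (x # y # xs)"
    then obtain i where i: "e = {(x # y # xs) ! i, (x # y # xs) ! Suc i}" "Suc i < length (x # y # xs)"
      by (auto simp: path_edges_def)
    then show "e \<in> insert {x, y} (path_edges (y # xs))"
      by (cases i) (auto simp: path_edges_def)
  next
    assume "e \<in> insert {x, y} (path_edges (y # xs))"
    then consider "e = {x, y}" | i where "e = {(y # xs) ! i, (y # xs) ! Suc i}" "Suc i < length (y # xs)"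
      by (auto simp: path_edges_def)
    then show "e \<in> path_edges (x # y # xs)"
    proof cases
      case 1
      then show ?thesis by (auto simp: path_edges_def intro!: exI[of _ 0])
    next
      case (2 i)
      then show ?thesis unfolding path_edges_def by (auto intro!: exI[of _ "Suc i"])
    qed
  qed
  then show ?thesis by blast
qed

lemma path_edges_append:
  "path_edges (xs @ ys) = path_edges xs \<union> path_edges ys \<union>
     (if xs = [] \<or> ys = [] then {} else {{last xs, hd ys}})"
proof (induction xs)
  case (Cons x xs)
  show ?case
  proof (cases xs)
    case Nil
    then show ?thesis by (cases ys) auto
  next
    case (Cons z zs)
    with Cons.IH show ?thesis by auto
  qed
qed simp

lemma path_edges_rev [simp]: "path_edges (rev p) = path_edges p"
proof (induction p)
  case (Cons x p)
  show ?case
  proof (cases p)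
    case (Cons a l)
    then have "path_edges (rev p @ [x]) = insert {a, x} (path_edges (rev p))"
      unfolding path_edges_append[of "rev p"] by (simp add: last_rev)
    with Cons.IH Cons show ?thesis by (simp add: insert_commute)
  qed simp
qed simp

lemma path_edges_subset_verts: "e \<in> path_edges p \<Longrightarrow> e \<subseteq> set p"
  by (auto simp: path_edges_def)

lemma path_edges_lattice_iff: "path_edges p \<subseteq> lattice_edges \<longleftrightarrow> successively adj p"
  by (induction p rule: induct_list012) auto

lemma successively_rev_adj: "successively adj (rev p) \<longleftrightarrow> successively adj p"
  by (simp only: path_edges_lattice_iff[symmetric] path_edges_rev)

text \<open>An interior vertex of a self-avoiding path carries exactly two path edges. This rigidity
  keeps the closed edges of the pattern off the detour and later forces a path through the whole
  corridor.\<close>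

lemma path_edges_at:
  assumes "distinct (xs @ [u, w, z] @ ys)"
  shows "{w, q} \<in> path_edges (xs @ [u, w, z] @ ys) \<longleftrightarrow> q = u \<or> q = z"
proof -
  have "w \<notin> set xs" "w \<notin> set ys" "w \<noteq> u" "w \<noteq> z" using assms by auto
  moreover have "{w, q} \<notin> path_edges p" if "w \<notin> set p" for p
    using path_edges_subset_verts[of "{w, q}" p] that by auto
  ultimately show ?thesis
    by (auto simp: path_edges_append doubleton_eq_iff)
qed

section \<open>The pattern on a cycle inside a rectangle\<close>

definition pattern_open :: "vertex \<Rightarrow> edge set" where
  "pattern_open t = fst (map_pattern (\<lambda>z. z + t) first_pattern)"

definition pattern_closed :: "vertex \<Rightarrow> edge set" where
  "pattern_closed t = snd (map_pattern (\<lambda>z. z + t) first_pattern)"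

lemma pattern_open_eq:
  "pattern_open (x, y) = {{(x, y), (x, y + 1)}, {(x, y + 1), (x + 1, y + 1)}, {(x + 1, y), (x + 1, y + 1)},
     {(x + 1, y), (x + 2, y)}, {(x + 2, y), (x + 2, y + 1)}}"
  by (simp add: pattern_open_def map_pattern_def first_pattern_def algebra_simps)

lemma pattern_closed_eq: "pattern_closed (x, y) = {{(x, y), (x + 1, y)}, {(x + 1, y + 1), (x + 2, y + 1)}}"
  by (simp add: pattern_closed_def map_pattern_def first_pattern_def algebra_simps)

definition rect :: "int \<Rightarrow> int \<Rightarrow> int \<Rightarrow> int \<Rightarrow> vertex set" where
  "rect x1 x2 y1 y2 = {x1..x2} \<times> {y1..y2}"

definition col :: "int \<Rightarrow> int \<Rightarrow> int \<Rightarrow> vertex list" where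
  "col x a b = map (\<lambda>y. (x, y)) [a..b]"

definition row :: "int \<Rightarrow> int \<Rightarrow> int \<Rightarrow> vertex list" where
  "row y a b = map (\<lambda>x. (x, y)) [a..b]"

lemma upto_ends:
  assumes "a \<le> b"
  shows "hd [a..b] = a" "last [a..b] = b" "[a..b] \<noteq> []"
  subgoal by (subst upto_rec1) (use assms in auto)
  subgoal by (subst upto_rec2) (use assms in auto)
  subgoal using assms by simp
  done

lemma successively_upto: "successively (\<lambda>x y. y = x + 1) [a..b::int]"
proof (induction a b rule: upto.induct)
  case (1 a b)
  then show ?case
  proof (cases "a < b")
    case True
    then have "[a..b] = a # (a + 1) # [a + 1 + 1..b]" by (simp add: upto_rec1)
    moreover have "[a + 1..b] = (a + 1) # [a + 1 + 1..b]" using True by (simp add: upto_rec1)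
    ultimately show ?thesis using 1 True by simp
  next
    case False
    then show ?thesis by (cases "a = b") auto
  qed
qed

lemma successively_col [simp]: "successively adj (col x a b)"
  and successively_row [simp]: "successively adj (row x a b)"
  unfolding col_def row_def successively_map
  by (rule successively_mono[OF successively_upto]; simp add: adj_def)+

lemma col_props:
  assumes "a \<le> b"
  shows "hd (col x a b) = (x, a)" "last (col x a b) = (x, b)" "col x a b \<noteq> []"
    and "hd (row x a b) = (a, x)" "last (row x a b) = (b, x)" "row x a b \<noteq> []"
  using upto_ends[OF assms] assms by (auto simp: col_def row_def hd_map last_map)

lemma set_col [simp]: "set (col x a b) = {x} \<times> {a..b}" "set (row x a b) = {a..b} \<times> {x}"
  by (auto simp: col_def row_def)

lemma distinct_col [simp]: "distinct (col x a b)" "distinct (row x a b)"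
  by (auto simp: col_def row_def distinct_map inj_on_def)

text \<open>The perimeter of the rectangle, cut open at the edge
  \<open>{(vx, y1), (vx + 1, y1)}\<close> of its bottom side, and a detour through the pattern at
  \<open>(vx, vy)\<close> that closes it up again.\<close>

definition perimeter :: "int \<Rightarrow> int \<Rightarrow> int \<Rightarrow> int \<Rightarrow> int \<Rightarrow> vertex list" where
  "perimeter x1 x2 y1 y2 vx =
     row y1 (vx + 1) x2 @ col x2 (y1 + 1) y2 @ rev (row y2 x1 (x2 - 1))
       @ rev (col x1 y1 (y2 - 1)) @ row y1 (x1 + 1) vx"

definition detour :: "int \<Rightarrow> int \<Rightarrow> int \<Rightarrow> vertex list" where
  "detour y1 vx vy =
     col vx (y1 + 1) vy @
     [(vx, vy + 1), (vx + 1, vy + 1), (vx + 1, vy), (vx + 2, vy), (vx + 2, vy + 1),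
      (vx + 3, vy + 1), (vx + 3, vy), (vx + 3, vy - 1), (vx + 2, vy - 1)]
     @ rev (col (vx + 1) (y1 + 1) (vy - 1))"

context
  fixes x1 x2 y1 y2 vx vy :: int
  assumes b: "x1 < vx" "vx + 3 < x2" "y1 + 1 < vy" "vy + 1 < y2"
begin

lemma distinct_loop: "distinct (perimeter x1 x2 y1 y2 vx @ detour y1 vx vy)"
  using b by (auto simp: perimeter_def detour_def)

lemma set_perimeter:
  "set (perimeter x1 x2 y1 y2 vx) =
     {z \<in> rect x1 x2 y1 y2. fst z = x1 \<or> fst z = x2 \<or> snd z = y1 \<or> snd z = y2}"
  using b by (auto simp: perimeter_def rect_def)

lemma set_detour: "set (detour y1 vx vy) \<subseteq> rect x1 x2 y1 y2"
  using b by (auto simp: detour_def rect_def)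

lemma successively_loop: "successively adj (perimeter x1 x2 y1 y2 vx @ detour y1 vx vy)"
  using b by (simp add: perimeter_def detour_def successively_append_iff successively_Cons col_props
      successively_rev_adj hd_append last_append hd_rev last_rev del: successively_rev)

lemma adj_loop_ends: "adj (last (detour y1 vx vy)) (hd (perimeter x1 x2 y1 y2 vx))"
  using b by (simp add: perimeter_def detour_def col_props
      hd_append last_append hd_rev last_rev)

lemma pattern_open_subset_detour: "pattern_open (vx, vy) \<subseteq> path_edges (detour y1 vx vy)"
  using b by (simp add: detour_def pattern_open_eq path_edges_append col_props insert_commute)

text \<open>Perimeter and detour together form a cycle. Removing the arc \<open>\<beta>\<close>
  strictly between \<open>u\<close> and \<open>w\<close> leaves a path that still contains the whole
  detour, hence the pattern.\<close>

lemma path_through_pattern_aux: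
  assumes "perimeter x1 x2 y1 y2 vx = \<alpha> @ [u] @ \<beta> @ [w] @ \<mu>"
  shows "\<exists>P. distinct P \<and> P \<noteq> [] \<and> set P \<subseteq> rect x1 x2 y1 y2 \<and> hd P = w \<and> last P = u \<and>
    path_edges P \<subseteq> lattice_edges \<and> pattern_open (vx, vy) \<subseteq> path_edges P \<and> pattern_closed (vx, vy) \<inter> path_edges P = {}"
proof -
  define D where "D = detour y1 vx vy"
  define P where "P = (w # \<mu>) @ D @ (\<alpha> @ [u])"
  have D: "D \<noteq> []" by (simp add: D_def detour_def)
  note loop = distinct_loop successively_loop adj_loop_ends set_perimeter set_detour
  have dist: "distinct P"
    using loop(1) unfolding assms P_def D_def[symmetric] by auto
  moreover have "set P \<subseteq> rect x1 x2 y1 y2"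
  proof -
    have "set (perimeter x1 x2 y1 y2 vx) \<subseteq> rect x1 x2 y1 y2"
      unfolding set_perimeter by auto
    with loop(5) show ?thesis unfolding assms P_def D_def by auto
  qed
  moreover have "successively adj P"
  proof -
    have "successively adj ((\<alpha> @ [u]) @ (\<beta> @ (w # \<mu>) @ D))"
      "successively adj ((\<alpha> @ [u] @ \<beta>) @ ((w # \<mu>) @ D))"
      using loop(2) unfolding assms D_def[symmetric] by simp_all
    then have "successively adj (\<alpha> @ [u])" "successively adj ((w # \<mu>) @ D)"
      unfolding successively_append_iff[of adj "\<alpha> @ [u]"]
        successively_append_iff[of adj "\<alpha> @ [u] @ \<beta>"] by blast+
    moreover have "hd (\<alpha> @ [u]) = hd (perimeter x1 x2 y1 y2 vx)"
      unfolding assms by (cases \<alpha>) auto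
    ultimately have "successively adj (((w # \<mu>) @ D) @ (\<alpha> @ [u]))"
      using loop(3) D unfolding successively_append_iff[of adj "(w # \<mu>) @ D"]
      by (simp add: D_def[symmetric])
    then show ?thesis by (simp add: P_def)
  qed
  moreover have "path_edges D \<subseteq> path_edges P"
    unfolding P_def path_edges_append by auto
  \<comment> \<open>The vertices \<open>(vx + 1, vy)\<close> and \<open>(vx + 1, vy + 1)\<close>
    already have both of their path edges among the open edges of the pattern. Each closed edge ends
    at one of them, so it cannot be a third.\<close>
  moreover have "pattern_closed (vx, vy) \<inter> path_edges P = {}"
  proof -
    define Q1 where "Q1 = (w # \<mu>) @ col vx (y1 + 1) vy"
    define Q2 where "Q2 = [(vx + 3, vy + 1), (vx + 3, vy), (vx + 3, vy - 1), (vx + 2, vy - 1)]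
     @ rev (col (vx + 1) (y1 + 1) (vy - 1)) @ \<alpha> @ [u]"
    have P1: "P = (Q1 @ [(vx, vy + 1)]) @ [(vx + 1, vy + 1), (vx + 1, vy), (vx + 2, vy)] @ ((vx + 2, vy + 1) # Q2)"
     and P2: "P = Q1 @ [(vx, vy + 1), (vx + 1, vy + 1), (vx + 1, vy)] @ ((vx + 2, vy) # (vx + 2, vy + 1) # Q2)"
      by (simp_all add: P_def D_def detour_def Q1_def Q2_def)
    show ?thesis
      using path_edges_at[OF dist[unfolded P1], of "(vx, vy)", folded P1]
        path_edges_at[OF dist[unfolded P2], of "(vx + 2, vy + 1)", folded P2]
      by (simp add: pattern_closed_eq insert_commute)
  qed
  ultimately show ?thesis
    using pattern_open_subset_detour unfolding path_edges_lattice_iff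
    by (intro exI[of _ P]) (auto simp: P_def D_def)
qed

lemma path_through_pattern:
  assumes "u \<noteq> w" "u \<in> set (perimeter x1 x2 y1 y2 vx)" "w \<in> set (perimeter x1 x2 y1 y2 vx)"
  shows "\<exists>P. distinct P \<and> P \<noteq> [] \<and> set P \<subseteq> rect x1 x2 y1 y2 \<and> hd P = u \<and> last P = w \<and>
    path_edges P \<subseteq> lattice_edges \<and> pattern_open (vx, vy) \<subseteq> path_edges P \<and> pattern_closed (vx, vy) \<inter> path_edges P = {}"
proof -
  obtain \<alpha> \<beta> where ab: "perimeter x1 x2 y1 y2 vx = \<alpha> @ u # \<beta>"
    using assms(2) by (meson split_list)
  with assms consider "w \<in> set \<alpha>" | "w \<in> set \<beta>" by auto
  then show ?thesis
  proof cases
    case 1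
    then obtain \<gamma> \<delta> where "\<alpha> = \<gamma> @ w # \<delta>" by (meson split_list)
    then show ?thesis using path_through_pattern_aux[of \<gamma> w \<delta> u \<beta>] ab by simp
  next
    case 2
    then obtain \<gamma> \<delta> where "\<beta> = \<gamma> @ w # \<delta>" by (meson split_list)
    then obtain P where "distinct P" "P \<noteq> []" "set P \<subseteq> rect x1 x2 y1 y2" "hd P = w" "last P = u"
      "path_edges P \<subseteq> lattice_edges" "pattern_open (vx, vy) \<subseteq> path_edges P" "pattern_closed (vx, vy) \<inter> path_edges P = {}"
      using path_through_pattern_aux[of \<alpha> u \<gamma> w \<delta>] ab by auto
    then show ?thesis by (intro exI[of _ "rev P"]) (auto simp: hd_rev last_rev)
  qed
qed

end

section \<open>Local surgery\<close>

text \<open>A path with both ends outside \<open>V\<close> enters and leaves each visited vertex of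
  \<open>V\<close> by different edges. If only edges of \<open>Q\<close> are available there, these
  are the two edges of \<open>Q\<close> at that vertex, so the visit propagates along
  \<open>Q\<close> in both directions.\<close>

lemma traverse_corridor:
  assumes Q: "Q = a # P @ [b]" "distinct Q" "P \<noteq> []" "set P \<subseteq> V" "a \<notin> V" "b \<notin> V"
    and p: "distinct p" "p \<noteq> []" "hd p \<notin> V" "last p \<notin> V"
    and only: "\<And>e. e \<in> path_edges p \<Longrightarrow> e \<inter> V \<noteq> {} \<Longrightarrow> e \<in> path_edges Q"
    and visits: "\<exists>e\<in>path_edges p. e \<inter> V \<noteq> {}"
  shows "path_edges Q \<subseteq> path_edges p"
proof -
  have inner: "Q ! k \<in> V" if "1 \<le> k" "Suc k < length Q" for k
  proof -
    have "Q ! k = P ! (k - 1)" using that Q(1) by (cases k) (auto simp: nth_append)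
    then show ?thesis using that Q(1,4) by (auto intro!: nth_mem)
  qed
  have local: "{Q ! (k - 1), Q ! k} \<in> path_edges p \<and> {Q ! k, Q ! Suc k} \<in> path_edges p"
    if k: "1 \<le> k" "Suc k < length Q" "Q ! k \<in> set p" for k
  proof -
    let ?w = "Q ! k"
    have w: "?w \<in> V" using inner k by blast
    obtain ys zs where split: "p = ys @ ?w # zs" using k(3) by (meson split_list)
    have "ys \<noteq> []" using split p(3) w by auto
    then obtain ys' u where ys: "ys = ys' @ [u]" by (meson rev_exhaust)
    have "zs \<noteq> []" using split p(4) w by auto
    then obtain z zs' where zs: "zs = z # zs'" by (meson list.exhaust)
    have peq: "p = ys' @ [u, ?w, z] @ zs'" using split ys zs by simp
    note at_p = path_edges_at[of ys' u ?w z zs', folded peq, OF p(1)]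
    have "Q = take (k - 1) Q @ [Q ! (k - 1), ?w, Q ! Suc k] @ drop (Suc (Suc k)) Q"
    proof -
      have "drop (k - 1) Q = Q ! (k - 1) # Q ! k # Q ! Suc k # drop (Suc (Suc k)) Q"
        using k Cons_nth_drop_Suc[of "k - 1" Q] Cons_nth_drop_Suc[of k Q]
          Cons_nth_drop_Suc[of "Suc k" Q] by simp
      then show ?thesis using append_take_drop_id[of "k - 1" Q] by simp
    qed
    note at_Q = path_edges_at[of "take (k - 1) Q" "Q ! (k - 1)" ?w "Q ! Suc k" "drop (Suc (Suc k)) Q",
        folded this, OF Q(2)]
    have "{?w, u} \<in> path_edges Q" "{?w, z} \<in> path_edges Q"
      using at_p only w by auto
    moreover have "u \<noteq> z" using p(1) peq by auto
    ultimately have "{?w, Q ! (k - 1)} \<in> path_edges p" "{?w, Q ! Suc k} \<in> path_edges p"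
      unfolding at_Q at_p by metis+
    then show ?thesis by (simp add: insert_commute)
  qed
  have verts: "Q ! (k - 1) \<in> set p \<and> Q ! Suc k \<in> set p"
    if "1 \<le> k" "Suc k < length Q" "Q ! k \<in> set p" for k
    using local[OF that] path_edges_subset_verts by blast
  obtain v where v: "v \<in> V" "v \<in> set p" "v \<in> set Q"
    using visits only path_edges_subset_verts by blast
  then have "v \<in> set P" using Q by auto
  then obtain i where "i < length P" "P ! i = v" by (meson in_set_conv_nth)
  then have i: "Q ! Suc i \<in> set p" "Suc (Suc i) < length Q"
    using Q(1) v(2) by (auto simp: nth_append)
  have up: "Q ! j \<in> set p" if "Suc i \<le> j" "j < length Q" for j
    using that
  proof (induction j rule: dec_induct)
    case base
    then show ?case using i by simp
  next
    case (step j)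
    then show ?case using verts[of j] by simp
  qed
  have down: "Q ! j \<in> set p" if "j \<le> Suc i" for j
    using that
  proof (induction j rule: inc_induct)
    case base
    then show ?case using i by simp
  next
    case (step j)
    then show ?case using verts[of "Suc j"] i by simp
  qed
  have all: "Q ! j \<in> set p" if "j < length Q" for j
    using up[of j] down[of j] that by linarith
  have len: "3 \<le> length Q" using i by simp
  show ?thesis
  proof
    fix e assume "e \<in> path_edges Q"
    then obtain j where j: "e = {Q ! j, Q ! Suc j}" "Suc j < length Q"
      by (auto simp: path_edges_def)
    show "e \<in> path_edges p"
    proof (cases j)
      case 0
      then show ?thesis using local[of 1] all[of 1] len j by simp
    next
      case (Suc k)
      then show ?thesis using local[of j] all[of j] j by simp
    qed
  qed
qed

section \<open>Configurations with switches, and crossings\<close>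

definition verts :: "vertex \<Rightarrow> vertex set" where
  "verts t = rect (fst t) (fst t + 2) (snd t) (snd t + 1)"

lemma pattern_closed_lattice: "pattern_closed t \<subseteq> lattice_edges"
  by (cases t) (simp add: pattern_closed_eq)

lemma pattern_edge_verts: "e \<in> pattern_open t \<union> pattern_closed t \<Longrightarrow> e \<subseteq> verts t"
  by (cases t) (auto simp: pattern_open_eq pattern_closed_eq verts_def rect_def)

lemma verts_covered: "z \<in> verts t \<Longrightarrow> \<exists>e\<in>pattern_open t. z \<in> e"
proof -
  assume z: "z \<in> verts t"
  obtain x y where t: "t = (x, y)" by (cases t)
  obtain a b where zz: "z = (a, b)" by (cases z)
  have "a = x \<or> a = x + 1 \<or> a = x + 2" "b = y \<or> b = y + 1"
    using z by (auto simp: verts_def rect_def t zz)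
  then show ?thesis unfolding t zz by (auto simp: pattern_open_eq)
qed

text \<open>An edge \<open>e\<close> has the coordinate \<open>Inl e\<close>; the coordinate \<open>Inr t\<close>
  switches off the pattern at \<open>t\<close>.\<close>

definition crossing :: "nat \<Rightarrow> vertex set \<Rightarrow> (edge + vertex) set \<Rightarrow> vertex list \<Rightarrow> bool" where
  "crossing n X S p \<longleftrightarrow> p \<noteq> [] \<and> distinct p \<and> hd p = (0, 0) \<and> last p \<in> box_boundary n \<and>
     set (butlast p) \<inter> box_boundary n = {} \<and>
     (\<forall>e\<in>path_edges p. e \<in> lattice_edges \<and> Inl e \<in> S) \<and>
     (\<forall>t\<in>X. pattern_open t \<subseteq> path_edges p \<longrightarrow> Inr t \<in> S \<or> (\<exists>e\<in>pattern_closed t. Inl e \<in> S))"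

text \<open>A crossing depends only on its own edges and, for each pattern of \<open>X\<close> that
  it contains, on the switch and the closed edges. Configurations need to be compared on these
  coordinates alone.\<close>

lemma crossing_transfer:
  assumes "crossing n X S p"
    and "\<And>e. e \<in> path_edges p \<Longrightarrow> Inl e \<in> S \<Longrightarrow> Inl e \<in> T"
    and "\<And>t. t \<in> X \<Longrightarrow> pattern_open t \<subseteq> path_edges p \<Longrightarrow> Inr t \<in> S \<Longrightarrow> Inr t \<in> T"
    and "\<And>t e. t \<in> X \<Longrightarrow> pattern_open t \<subseteq> path_edges p \<Longrightarrow> e \<in> pattern_closed t \<Longrightarrow> Inl e \<in> S \<Longrightarrow> Inl e \<in> T"
  shows "crossing n X T p"
  using assms unfolding crossing_def by blast

lemma crossing_mono: "crossing n X S p \<Longrightarrow> S \<subseteq> T \<Longrightarrow> crossing n X T p"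
  by (erule crossing_transfer) auto

text \<open>Edges with a single endpoint in \<open>V\<close> are included, so that clearing the set
  seals \<open>V\<close> off. Switches are not, so a change confined to it needs no bound on their
  probabilities.\<close>

definition touching :: "vertex set \<Rightarrow> (edge + vertex) set" where
  "touching V = Inl ` {e \<in> lattice_edges. e \<inter> V \<noteq> {}}"

text \<open>The last clause excludes the following obstruction: if two neighbours of \<open>u\<close> lie outside
  the rectangle, then a path can use \<open>u\<close> as its only vertex of the rectangle, and no
  rerouting inside the rectangle can send it through the pattern.\<close>

definition good_region ::
  "nat \<Rightarrow> vertex set \<Rightarrow> vertex \<Rightarrow> int \<Rightarrow> int \<Rightarrow> int \<Rightarrow> int \<Rightarrow> vertex \<Rightarrow> bool" where
  "good_region n X u x1 x2 y1 y2 t \<longleftrightarrow>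
     x1 < fst t \<and> fst t + 3 < x2 \<and> y1 + 1 < snd t \<and> snd t + 1 < y2 \<and>
     t \<in> X \<and> (\<forall>t'\<in>X. t' \<noteq> t \<longrightarrow> verts t' \<inter> rect x1 x2 y1 y2 = {}) \<and>
     (0, 0) \<notin> rect x1 x2 y1 y2 \<and> rect x1 x2 y1 y2 \<inter> box_boundary n = {} \<and>
     u \<in> rect x1 x2 y1 y2 \<and>
     (\<forall>a b. adj u a \<longrightarrow> adj u b \<longrightarrow> a \<noteq> b \<longrightarrow> a \<notin> rect x1 x2 y1 y2 \<longrightarrow> b \<notin> rect x1 x2 y1 y2 \<longrightarrow>
        a \<in> box_boundary n)"

section \<open>Replacing the middle of a path\<close>

lemma path_edges_append_last:
  assumes "xs \<noteq> []"
  shows "path_edges (xs @ ys) = path_edges xs \<union> path_edges (last xs # ys)"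
  unfolding path_edges_append[of xs] using assms by (cases ys) simp_all

lemma path_edges_sandwich:
  "path_edges (xs @ [a] @ P @ [b] @ ys) =
     path_edges (xs @ [a]) \<union> path_edges (a # P @ [b]) \<union> path_edges (b # ys)"
  using path_edges_append_last[of "xs @ [a]" "P @ [b] @ ys"]
    path_edges_append_last[of "a # P @ [b]" ys]
  by (simp add: Un_assoc)

lemma path_edges_corridor:
  assumes "P \<noteq> []"
  shows "path_edges (a # P @ [b]) = insert {a, hd P} (insert {last P, b} (path_edges P))"
proof -
  have "path_edges (a # P @ [b]) = insert {a, hd P} (path_edges (P @ [b]))"
    using assms by (cases P) simp_all
  then show ?thesis
    using path_edges_append_last[OF assms, of "[b]"] by simp
qed

text \<open>\<open>M\<close> may leave \<open>V\<close> and return; only its two ends matter, since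
  it is replaced as a whole.\<close>

lemma first_last_visit:
  assumes "set p \<inter> V \<noteq> {}" "hd p \<notin> V" "last p \<notin> V"
  obtains \<xi> a M b \<eta> where "p = \<xi> @ [a] @ M @ [b] @ \<eta>" "set (\<xi> @ [a]) \<inter> V = {}" "set (b # \<eta>) \<inter> V = {}"
    "M \<noteq> []" "hd M \<in> V" "last M \<in> V"
proof -
  obtain ys x zs where 1: "p = ys @ x # zs" "x \<in> V" "\<forall>y\<in>set ys. y \<notin> V"
    using split_list_first_prop[of p "\<lambda>v. v \<in> V"] assms(1) by blast
  have "\<exists>v\<in>set (x # zs). v \<in> V" using 1 by auto
  then obtain ys' x' zs' where 2: "x # zs = ys' @ x' # zs'" "x' \<in> V" "\<forall>y\<in>set zs'. y \<notin> V"
    using split_list_last_prop[of "x # zs" "\<lambda>v. v \<in> V"] by blast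
  have "ys \<noteq> []" using 1 assms(2) by auto
  then obtain \<xi> a where ys: "ys = \<xi> @ [a]" by (meson rev_exhaust)
  have "zs' \<noteq> []"
  proof
    assume "zs' = []"
    then have "last p = x'" using 1(1) 2(1) by (metis last_appendR last_snoc list.distinct(1))
    with 2 assms(3) show False by simp
  qed
  then obtain b \<eta> where zs: "zs' = b # \<eta>" by (meson list.exhaust)
  have "hd (ys' @ [x']) = x" using 2(1) by (cases ys') auto
  then show ?thesis
    using that[of \<xi> a "ys' @ [x']" b \<eta>] 1 2 ys zs by auto
qed

text \<open>In the new configuration the only open edges meeting the rectangle form one corridor
  through the pattern. With the switch on, the diverted path crosses. With it off, a crossing that
  avoids the rectangle would cross already in \<open>S - {Inl e}\<close>, and one that enters it
  runs through the whole corridor and so uses the pattern.\<close>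

lemma surgery:
  assumes reg: "good_region n X u x1 x2 y1 y2 t"
    and e: "e \<in> lattice_edges" "u \<in> e"
    and piv: "pivotal (Inl e) (\<lambda>S. \<exists>p. crossing n X S p) S"
  shows "\<exists>T. T \<subseteq> S \<union> touching (rect x1 x2 y1 y2) \<and>
    T - touching (rect x1 x2 y1 y2) = S - touching (rect x1 x2 y1 y2) \<and>
    pivotal (Inr t) (\<lambda>S. \<exists>p. crossing n X S p) T"
proof -
  define V where "V = rect x1 x2 y1 y2"
  note reg' = reg[unfolded good_region_def, folded V_def]
  from reg' have t: "x1 < fst t" "fst t + 3 < x2" "y1 + 1 < snd t" "snd t + 1 < y2" "t \<in> X"
    and V: "(0, 0) \<notin> V" "V \<inter> box_boundary n = {}" and u: "u \<in> V"
    by simp_all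
  from reg' have others: "t' = t" if "t' \<in> X" "verts t' \<inter> V \<noteq> {}" for t'
    using that by metis
  from reg' have corner: "a \<in> box_boundary n"
    if "adj u a" "adj u b" "a \<noteq> b" "a \<notin> V" "b \<notin> V" for a b
    using that by metis
  have tV: "verts t \<subseteq> V" using t by (auto simp: verts_def V_def rect_def)
  have far: "pattern_open t' \<subseteq> A \<Longrightarrow> (\<And>e. e \<in> A \<Longrightarrow> e \<inter> V = {}) \<Longrightarrow> verts t' \<inter> V = {}" for t' A
    using verts_covered by blast
  obtain p where p: "crossing n X (insert (Inl e) S) p" and no: "\<And>p. \<not> crossing n X (S - {Inl e}) p"
    using piv unfolding pivotal_def by blast
  have pprops: "p \<noteq> []" "distinct p" "hd p \<notin> V" "last p \<notin> V" "path_edges p \<subseteq> lattice_edges"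
    using p V unfolding crossing_def by auto
  \<comment> \<open>The edge \<open>e\<close> can matter to \<open>p\<close> without lying on it, as
    a closed edge of a pattern that \<open>p\<close> contains. That pattern has \<open>u\<close> as
    a vertex, and each of its vertices lies on an open edge of it, so \<open>p\<close> still meets
    \<open>V\<close>.\<close>
  have e_eq: "\<exists>e'\<in>path_edges p. e' = e \<or> e' \<inter> V \<noteq> {}"
  proof (rule ccontr)
    assume *: "\<not> ?thesis"
    have "crossing n X (S - {Inl e}) p"
    proof (rule crossing_transfer[OF p])
      fix t' e' assume "t' \<in> X" "pattern_open t' \<subseteq> path_edges p" "e' \<in> pattern_closed t'" "Inl e' \<in> insert (Inl e) S"
      moreover have "verts t' \<inter> V = {}" using far calculation(2) * by blast
      ultimately show "Inl e' \<in> S - {Inl e}"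
        using pattern_edge_verts[of e' t'] e(2) u by auto
    qed (use * in auto)
    with no show False by blast
  qed
  then have "set p \<inter> V \<noteq> {}"
    using path_edges_subset_verts[of _ p] e(2) u by blast
  from first_last_visit[OF this pprops(3,4)]
  obtain \<xi> a M b \<eta> where p_eq: "p = \<xi> @ [a] @ M @ [b] @ \<eta>"
    and out: "set (\<xi> @ [a]) \<inter> V = {}" "set (b # \<eta>) \<inter> V = {}"
    and M: "M \<noteq> []" "hd M \<in> V" "last M \<in> V" .
  have ab: "a \<notin> V" "b \<notin> V" "a \<noteq> b" using out pprops(2) p_eq by auto
  have "path_edges (a # M @ [b]) \<subseteq> lattice_edges"
    using pprops(5) unfolding p_eq path_edges_sandwich by blast
  then have adj_ab: "adj a (hd M)" "adj (last M) b"
    unfolding path_edges_corridor[OF M(1)] by auto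
  \<comment> \<open>Otherwise \<open>p\<close> meets \<open>V\<close> in one vertex only. If
    \<open>e\<close> lies on \<open>p\<close>, this vertex is \<open>u\<close> and the last clause
    of \<open>good_region\<close> applies to its outer neighbours; if \<open>e\<close> matters as a
    closed edge, \<open>p\<close> would visit all six vertices of the pattern at
    \<open>t\<close>.\<close>
  have ne: "hd M \<noteq> last M"
  proof
    assume eq: "hd M = last M"
    have "distinct M" using pprops(2) p_eq by auto
    with eq M(1) obtain c where M1: "M = [c]"
      by (cases M) (auto split: if_splits)
    then have "set M = {hd M}" using M1 by simp
    moreover have "set p = set (\<xi> @ [a]) \<union> set M \<union> set (b # \<eta>)" by (auto simp: p_eq)
    ultimately have pV: "set p \<inter> V \<subseteq> {hd M}" using out by blast
    show False
    proof (cases "e \<in> path_edges p")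
      case True
      then have "u = hd M" using path_edges_subset_verts e(2) u pV by blast
      then have "a \<in> box_boundary n"
        using corner[of a b] adj_ab ab eq adj_sym by metis
      \<comment> \<open>\<open>a\<close> comes before the end of \<open>p\<close>, whereas a
        crossing meets the target only at its end.\<close>
      moreover have "a \<in> set (butlast p)" unfolding p_eq by (simp add: butlast_append)
      ultimately show False using p unfolding crossing_def by blast
    next
      case False
      have "\<exists>t'\<in>X. pattern_open t' \<subseteq> path_edges p \<and> e \<in> pattern_closed t'"
      proof (rule ccontr)
        assume *: "\<not> ?thesis"
        have "crossing n X (S - {Inl e}) p"
          by (rule crossing_transfer[OF p]) (use * False in auto)
        with no show False by blast
      qed
      then obtain t' where t': "t' \<in> X" "pattern_open t' \<subseteq> path_edges p" "e \<in> pattern_closed t'" by blast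
      then have "u \<in> verts t'" using pattern_edge_verts e(2) by blast
      then have "t' = t" using others[OF t'(1)] u by blast
      then have "verts t \<subseteq> set p \<inter> V"
        using t'(2) verts_covered path_edges_subset_verts tV by blast
      with pV have "verts t \<subseteq> {hd M}" by blast
      moreover have "(fst t, snd t) \<in> verts t" "(fst t + 1, snd t) \<in> verts t"
        by (simp_all add: verts_def rect_def mem_Times_iff)
      ultimately have "(fst t, snd t) = hd M" "(fst t + 1, snd t) = hd M"
        by (meson singletonD subsetD)+
      then show False by (metis add_cancel_right_right fst_conv zero_neq_one)
    qed
  qed
  have perim: "v \<in> set (perimeter x1 x2 y1 y2 (fst t))" if "v \<in> V" "adj v c" "c \<notin> V" for v c
    using that unfolding set_perimeter[OF t(1-4)] V_def rect_def by (auto simp: adj_def mem_Times_iff)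
  have "hd M \<in> set (perimeter x1 x2 y1 y2 (fst t))" "last M \<in> set (perimeter x1 x2 y1 y2 (fst t))"
    using perim M adj_ab ab adj_sym by blast+
  from path_through_pattern[OF t(1-4) ne this]
  obtain P where P: "distinct P" "P \<noteq> []" "set P \<subseteq> V" "hd P = hd M" "last P = last M"
    "path_edges P \<subseteq> lattice_edges" "pattern_open t \<subseteq> path_edges P" "pattern_closed t \<inter> path_edges P = {}"
    unfolding V_def by auto
  define Q where "Q = a # P @ [b]"
  have Q_edges: "path_edges Q = insert {a, hd P} (insert {last P, b} (path_edges P))"
    unfolding Q_def by (rule path_edges_corridor[OF P(2)])
  have PV: "hd P \<in> V" "last P \<in> V" using P M by auto
  have Q_lattice: "path_edges Q \<subseteq> lattice_edges"
    unfolding Q_edges using P adj_ab by simp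
  have Q_meets: "e' \<inter> V \<noteq> {}" if e': "e' \<in> path_edges Q" for e'
  proof -
    from e' consider "hd P \<in> e'" | "last P \<in> e'" | "e' \<in> path_edges P" unfolding Q_edges by blast
    then show ?thesis
    proof cases
      case 3
      then obtain i where "P ! i \<in> e'" "i < length P" by (auto simp: path_edges_def)
      then show ?thesis using P(3) nth_mem by blast
    qed (use PV in blast)+
  qed
  define T where "T = (S - touching V) \<union> Inl ` path_edges Q"
  have Q_touch: "Inl ` path_edges Q \<subseteq> touching V"
    unfolding touching_def
    by (intro image_mono subsetI CollectI conjI subsetD[OF Q_lattice] Q_meets)
  have T_Inl: "Inl e' \<in> T \<longleftrightarrow> Inl e' \<in> S" if "e' \<inter> V = {}" for e'
    using that Q_meets[of e'] by (simp add: T_def touching_def inj_image_mem_iff image_iff) blast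
  have T_Inl': "Inl e' \<in> T \<Longrightarrow> e' \<in> path_edges Q" if "e' \<inter> V \<noteq> {}" "e' \<in> lattice_edges" for e'
    using that by (simp add: T_def touching_def image_iff)
  have T_Inr: "Inr t' \<in> T \<longleftrightarrow> Inr t' \<in> S" for t'
    by (simp add: T_def touching_def image_iff)
  define p' where "p' = \<xi> @ [a] @ P @ [b] @ \<eta>"
  have p'_edges: "path_edges p' = path_edges (\<xi> @ [a]) \<union> path_edges Q \<union> path_edges (b # \<eta>)"
    unfolding p'_def path_edges_sandwich Q_def ..
  have p_edges: "path_edges (\<xi> @ [a]) \<union> path_edges (b # \<eta>) \<subseteq> path_edges p"
    unfolding p_eq path_edges_sandwich by blast
  have p'_p: "e' \<in> path_edges p" if "e' \<in> path_edges p'" "e' \<inter> V = {}" for e'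
    using that p'_edges p_edges Q_meets by blast
  have not_e: "e' \<noteq> e" if "e' \<inter> V = {}" for e' using that e(2) u by blast
  have "crossing n X (insert (Inr t) T) p'"
    unfolding crossing_def
  proof (intro conjI ballI impI)
    show "p' \<noteq> []" "distinct p'"
      using P(1,3) out pprops(2) by (auto simp: p'_def p_eq)
    have "hd p' = hd p" "last p' = last p"
      by (simp_all add: p'_def p_eq hd_append last_append)
    then show "hd p' = (0, 0)" "last p' \<in> box_boundary n"
      using p by (auto simp: crossing_def)
    have "set (butlast p') \<subseteq> set (butlast p) \<union> V"
      using P(3) by (auto simp: p'_def p_eq butlast_append)
    then show "set (butlast p') \<inter> box_boundary n = {}"
      using p V(2) by (auto simp: crossing_def)
  next
    fix e' assume e': "e' \<in> path_edges p'"
    show "e' \<in> lattice_edges" using e' p'_edges p_edges pprops(5) Q_lattice by blast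
    show "Inl e' \<in> insert (Inr t) T"
    proof (cases "e' \<in> path_edges Q")
      case False
      then have 1: "e' \<in> path_edges (\<xi> @ [a]) \<union> path_edges (b # \<eta>)" using e' p'_edges by blast
      then have "e' \<inter> V = {}" using out path_edges_subset_verts by blast
      moreover have "Inl e' \<in> insert (Inl e) S" using p 1 p_edges unfolding crossing_def by blast
      ultimately show ?thesis using T_Inl not_e by blast
    qed (simp add: T_def)
  next
    fix t' assume t': "t' \<in> X" "pattern_open t' \<subseteq> path_edges p'"
    show "Inr t' \<in> insert (Inr t) T \<or> (\<exists>e\<in>pattern_closed t'. Inl e \<in> insert (Inr t) T)"
    proof (cases "t' = t")
      case False
      \<comment> \<open>A pattern of \<open>X\<close> other than the one at \<open>t\<close> lies
        off \<open>V\<close>, where \<open>p'\<close> has only edges of \<open>p\<close> and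
        \<open>T\<close> agrees with \<open>S\<close>; its constraint is inherited from
        \<open>p\<close>.\<close>
      then have v: "verts t' \<inter> V = {}" using others t'(1) by blast
      then have miss: "e' \<inter> V = {}" if "e' \<in> pattern_open t' \<union> pattern_closed t'" for e'
        using pattern_edge_verts[OF that] by blast
      have "pattern_open t' \<subseteq> path_edges p" using t'(2) p'_p miss by blast
      then consider "Inr t' \<in> insert (Inl e) S" | e' where "e' \<in> pattern_closed t'" "Inl e' \<in> insert (Inl e) S"
        using p t'(1) unfolding crossing_def by blast
      then show ?thesis
      proof cases
        case 1
        then show ?thesis using T_Inr by blast
      next
        case (2 e')
        then have "Inl e' \<in> T" using T_Inl[of e'] miss[of e'] not_e[of e'] by blast
        then show ?thesis using 2(1) by blast
      qed
    qed simp
  qed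
  moreover have "\<not> crossing n X (T - {Inr t}) p''" for p''
  proof
    assume p'': "crossing n X (T - {Inr t}) p''"
    show False
    proof (cases "\<exists>e'\<in>path_edges p''. e' \<inter> V \<noteq> {}")
      case False
      have "crossing n X (S - {Inl e}) p''"
      proof (rule crossing_transfer[OF p''])
        fix t' e' assume 1: "t' \<in> X" "pattern_open t' \<subseteq> path_edges p''" "e' \<in> pattern_closed t'" "Inl e' \<in> T - {Inr t}"
        then have "verts t' \<inter> V = {}" using far False by blast
        then have "e' \<inter> V = {}" using pattern_edge_verts[of e' t'] 1(3) by blast
        then show "Inl e' \<in> S - {Inl e}" using T_Inl not_e 1(4) by blast
      qed (use False T_Inl T_Inr not_e in auto)
      with no show False by blast
    next
      case True
      have "path_edges Q \<subseteq> path_edges p''"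
      proof (rule traverse_corridor[OF Q_def])
        show "distinct Q" using P(1,3) ab by (auto simp: Q_def)
        show "e' \<in> path_edges Q" if "e' \<in> path_edges p''" "e' \<inter> V \<noteq> {}" for e'
          using that p'' T_Inl' unfolding crossing_def by blast
      qed (use P ab p'' V True in \<open>auto simp: crossing_def\<close>)
      then have "pattern_open t \<subseteq> path_edges p''" using P(7) Q_edges by blast
      then obtain e' where e': "e' \<in> pattern_closed t" "Inl e' \<in> T"
        using p'' t(5) unfolding crossing_def by blast
      \<comment> \<open>The two end edges of the corridor leave \<open>V\<close>. A closed edge of
        the pattern stays inside \<open>V\<close>, so if it were open in \<open>T\<close> it would
        be an edge of \<open>P\<close>, which avoids it.\<close>
      have "e' \<subseteq> V" using pattern_edge_verts[of e' t] e'(1) tV by blast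
      moreover have "e' \<in> lattice_edges" using pattern_closed_lattice e'(1) by blast
      moreover have "e' \<noteq> {}" using e'(1) by (cases t) (auto simp: pattern_closed_eq)
      ultimately have "e' \<in> path_edges Q" using T_Inl'[of e'] e'(2) by blast
      with \<open>e' \<subseteq> V\<close> ab e'(1) P(8) show False unfolding Q_edges by blast
    qed
  qed
  ultimately have "pivotal (Inr t) (\<lambda>S. \<exists>p. crossing n X S p) T"
    unfolding pivotal_def by blast
  moreover have "T - touching V = S - touching V" "T \<subseteq> S \<union> touching V"
    using Q_touch by (auto simp: T_def)
  ultimately show ?thesis unfolding V_def by blast
qed

section \<open>Rectangles around the edges of the square\<close>

text \<open>One coordinate of a region: \<open>t\<close> is the only admissible grid coordinate
  whose pattern, up to \<open>t + 2\<close>, can meet \<open>[lo, hi]\<close>, and the margin 4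
  leaves room for the detour. \<open>x\<close> may be an end of the interval only where
  \<open>[A, B]\<close> ends too, which limits the neighbours of \<open>u\<close> outside the
  region.\<close>

definition slot :: "(int \<Rightarrow> bool) \<Rightarrow> int \<Rightarrow> int \<Rightarrow> int \<Rightarrow> int \<Rightarrow> int \<Rightarrow> int \<Rightarrow> bool" where
  "slot T A B x lo hi t \<longleftrightarrow> T t \<and> A \<le> lo \<and> lo \<le> x \<and> x \<le> hi \<and> hi \<le> B \<and>
     (lo = A \<or> lo < x) \<and> (hi = B \<or> x < hi) \<and> lo + 4 \<le> t \<and> t + 4 \<le> hi \<and> hi \<le> lo + 60 \<and>
     (\<forall>t'. T t' \<longrightarrow> t' \<noteq> t \<longrightarrow> t' + 2 < lo \<or> hi < t')"

lemma slotD: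
  assumes "slot T A B x lo hi t"
  shows "T t" "A \<le> lo" "lo \<le> x" "x \<le> hi" "hi \<le> B" "lo = A \<or> lo < x" "hi = B \<or> x < hi"
    and "lo + 4 \<le> t" "t + 4 \<le> hi" "hi \<le> lo + 60"
    and "\<And>t'. T t' \<Longrightarrow> t' \<noteq> t \<Longrightarrow> t' + 2 < lo \<or> hi < t'"
  using assms by (simp_all add: slot_def)

lemma slot_exists:
  fixes A B x :: int
  assumes "A + 60 \<le> B" "A \<le> x" "x \<le> B"
  shows "\<exists>lo hi t. slot (\<lambda>t. t mod 20 = 10 \<and> A + 4 \<le> t \<and> t \<le> B - 4) A B x lo hi t"
proof -
  \<comment> \<open>The grid coordinate in the block of 20 that contains \<open>x\<close>; if it is
    too close to an end of \<open>[A, B]\<close>, the next one inward is taken.\<close>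
  define t0 where "t0 = 20 * (x div 20) + 10"
  define t where "t = (if t0 < A + 4 then t0 + 20 else if B - 4 < t0 then t0 - 20 else t0)"
  \<comment> \<open>The preceding pattern ends at \<open>t - 18\<close> and the next one starts at
    \<open>t + 20\<close>. Where no admissible neighbour exists, the interval extends to the end of
    \<open>[A, B]\<close>.\<close>
  define lo where "lo = (if A + 4 \<le> t - 20 then t - 17 else A)"
  define hi where "hi = (if t + 20 \<le> B - 4 then t + 19 else B)"
  have x: "t0 - 10 \<le> x" "x \<le> t0 + 9"
    unfolding t0_def by presburger+
  have "t = 20 * (x div 20) + 10 \<or> t = 20 * (x div 20 + 1) + 10 \<or> t = 20 * (x div 20 - 1) + 10"
    by (simp add: t_def t0_def)
  moreover have "(20 * k + 10) mod 20 = (10 :: int)" for k by presburger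
  ultimately have tmod: "t mod 20 = 10" by metis
  moreover have "A + 4 \<le> t" "t \<le> B - 4" "A \<le> lo" "lo \<le> x" "x \<le> hi" "hi \<le> B"
    "lo = A \<or> lo < x" "hi = B \<or> x < hi" "lo + 4 \<le> t" "t + 4 \<le> hi" "hi \<le> lo + 60"
    using assms x unfolding lo_def hi_def t_def by auto
  moreover have "t' + 2 < lo \<or> hi < t'"
    if t': "t' mod 20 = 10" "A + 4 \<le> t'" "t' \<le> B - 4" "t' \<noteq> t" for t'
  proof -
    have "t' \<le> t - 20 \<or> t + 20 \<le> t'" using t'(1,4) tmod by presburger
    then show ?thesis using t'(2,3) unfolding lo_def hi_def by auto
  qed
  ultimately have "slot (\<lambda>t. t mod 20 = 10 \<and> A + 4 \<le> t \<and> t \<le> B - 4) A B x lo hi t"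
    unfolding slot_def by blast
  then show ?thesis by blast
qed

text \<open>The residue 10 keeps grid coordinates away from 0, so an interval cut off at 1 or -1
  meets no pattern from the other side. The bound \<open>int m - 4\<close> provides the margin of
  the detour.\<close>

definition grid :: "nat \<Rightarrow> vertex set" where
  "grid m = {t. fst t mod 20 = 10 \<and> snd t mod 20 = 10 \<and> \<bar>fst t\<bar> \<le> int m - 4 \<and> \<bar>snd t\<bar> \<le> int m - 4}"

text \<open>The two half ranges omit 0, which is how a region avoids the origin; their length
  \<open>m - 1\<close> is at least 60 once \<open>m\<close> is at least 61.\<close>

lemma grid_slot_exists:
  fixes m A B x :: int
  assumes m: "61 \<le> m" and AB: "(A, B) \<in> {(-m, m), (1, m), (-m, -1)}" and x: "A \<le> x" "x \<le> B"
  shows "\<exists>lo hi t. slot (\<lambda>t. t mod 20 = 10 \<and> \<bar>t\<bar> \<le> m - 4) A B x lo hi t"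
proof -
  have "A + 60 \<le> B" using m AB by auto
  from slot_exists[OF this x] obtain lo hi t where
    *: "slot (\<lambda>t. t mod 20 = 10 \<and> A + 4 \<le> t \<and> t \<le> B - 4) A B x lo hi t" by blast
  have "t' + 2 < lo \<or> hi < t'" if t': "t' mod 20 = 10" "\<bar>t'\<bar> \<le> m - 4" "t' \<noteq> t" for t'
  proof (cases "A + 4 \<le> t' \<and> t' \<le> B - 4")
    case True
    then show ?thesis using slotD(11)[OF *, of t'] t' by simp
  next
    case False
    have "t' \<le> -10 \<or> 10 \<le> t'" using t'(1) by presburger
    moreover have "A \<le> lo" "hi \<le> B" using slotD(2,5)[OF *] by simp_all
    ultimately show ?thesis using False AB t'(2) by auto
  qed
  moreover have "A + 4 \<le> t" "t \<le> B - 4" using slotD(1)[OF *] by simp_all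
  then have "\<bar>t\<bar> \<le> m - 4" using AB m by auto
  ultimately have "slot (\<lambda>t. t mod 20 = 10 \<and> \<bar>t\<bar> \<le> m - 4) A B x lo hi t"
    using * unfolding slot_def by blast
  then show ?thesis by blast
qed

section \<open>Vertices with two neighbours outside their region\<close>

text \<open>A step in the first coordinate leaves the rectangle only if |x| = M, and at most one
  step in the second coordinate leaves it because of the height. Two outer neighbours thus force |x|
  = M, then |y| = M, and both lie just beyond the square.\<close>

lemma outer_neighbour_on_target:
  fixes M x y :: int
  assumes xy: "\<bar>x\<bar> \<le> \<bar>y\<bar>" "\<bar>y\<bar> \<le> M"
    and r: "x1 + 8 \<le> x2" "y1 + 8 \<le> y2" "- M \<le> x1" "x2 \<le> M" "- M \<le> y1" "y2 \<le> M"
      "x1 \<le> x" "x \<le> x2" "y1 \<le> y" "y \<le> y2" "x1 = - M \<or> x1 < x" "x2 = M \<or> x < x2"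
    and a: "\<bar>x - a1\<bar> + \<bar>y - a2\<bar> = 1" "a1 < x1 \<or> x2 < a1 \<or> a2 < y1 \<or> y2 < a2"
    and b: "\<bar>x - b1\<bar> + \<bar>y - b2\<bar> = 1" "b1 < x1 \<or> x2 < b1 \<or> b2 < y1 \<or> y2 < b2"
    and ab: "a1 \<noteq> b1 \<or> a2 \<noteq> b2"
  shows "max \<bar>a1\<bar> \<bar>a2\<bar> = M + 1"
proof -
  have M: "0 \<le> M" using r(1,3,4) by linarith
  have side: "\<bar>x\<bar> = M \<and> c2 = y \<and> \<bar>c1\<bar> = M + 1 \<or> c1 = x \<and> (c2 = y + 1 \<and> y = y2 \<or> c2 = y - 1 \<and> y = y1)"
    if "\<bar>x - c1\<bar> + \<bar>y - c2\<bar> = 1" "c1 < x1 \<or> x2 < c1 \<or> c2 < y1 \<or> y2 < c2" for c1 c2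
  proof -
    have "c1 = x + 1 \<and> c2 = y \<or> c1 = x - 1 \<and> c2 = y \<or> c1 = x \<and> c2 = y + 1 \<or> c1 = x \<and> c2 = y - 1"
      using that(1) by arith
    then consider "c1 = x + 1" "c2 = y" | "c1 = x - 1" "c2 = y" | "c1 = x" "c2 = y + 1" | "c1 = x" "c2 = y - 1"
      by blast
    then show ?thesis
    proof cases
      case 1
      then have "x2 < x + 1" using that(2) r(7,9,10) by auto
      then have "x = M" using r(8,12) by auto
      then show ?thesis using 1 M by auto
    next
      case 2
      then have "x - 1 < x1" using that(2) r(8,9,10) by auto
      then have "x = - M" using r(7,11) by auto
      then show ?thesis using 2 M by auto
    next
      case 3
      then have "y2 < y + 1" using that(2) r(7,8,9) by auto
      then show ?thesis using 3 r(10) by auto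
    next
      case 4
      then have "y - 1 < y1" using that(2) r(7,8,10) by auto
      then show ?thesis using 4 r(9) by auto
    qed
  qed
  from side[OF a] show ?thesis
  proof
    assume "\<bar>x\<bar> = M \<and> a2 = y \<and> \<bar>a1\<bar> = M + 1"
    then show ?thesis using xy by auto
  next
    assume *: "a1 = x \<and> (a2 = y + 1 \<and> y = y2 \<or> a2 = y - 1 \<and> y = y1)"
    with side[OF b] ab r(2) have "\<bar>x\<bar> = M" by auto
    then have "\<bar>y\<bar> = M" using xy by auto
    with * r(2,5,6) have "\<bar>a2\<bar> = M + 1" by auto
    then show ?thesis using * xy by auto
  qed
qed

text \<open>The rectangle avoids the origin in the direction of the longer coordinate of \<open>u\<close>. With
  this choice \<open>u\<close> is a corner of the rectangle only if both of its outer neighbours lie on the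
  target.\<close>

lemma good_region_aux:
  fixes m :: nat
  assumes m: "61 \<le> m" and xy: "\<bar>x\<bar> \<le> int m" "\<bar>y\<bar> \<le> int m" "(x, y) \<noteq> (0, 0)"
    and A: "(A, B) \<in> {(- int m, int m), (1, int m), (- int m, -1)}" "A \<le> x" "x \<le> B"
    and C: "(C, D) \<in> {(- int m, int m), (1, int m), (- int m, -1)}" "C \<le> y" "y \<le> D"
    and choice: "\<bar>x\<bar> \<le> \<bar>y\<bar> \<and> A = - int m \<and> B = int m \<and> 0 \<notin> {C..D} \<or>
      \<bar>y\<bar> \<le> \<bar>x\<bar> \<and> C = - int m \<and> D = int m \<and> 0 \<notin> {A..B}"
  shows "\<exists>x1 x2 y1 y2 t. good_region (Suc m) (grid m) (x, y) x1 x2 y1 y2 t \<and> x2 \<le> x1 + 60 \<and> y2 \<le> y1 + 60 \<and>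
    rect x1 x2 y1 y2 \<subseteq> rect (- int m) (int m) (- int m) (int m)"
proof -
  have m': "61 \<le> int m" using m by simp
  obtain x1 x2 s where X: "slot (\<lambda>t. t mod 20 = 10 \<and> \<bar>t\<bar> \<le> int m - 4) A B x x1 x2 s"
    using grid_slot_exists[OF m' A] by blast
  obtain y1 y2 t where Y: "slot (\<lambda>t. t mod 20 = 10 \<and> \<bar>t\<bar> \<le> int m - 4) C D y y1 y2 t"
    using grid_slot_exists[OF m' C] by blast
  have X': "s mod 20 = 10" "\<bar>s\<bar> \<le> int m - 4" "A \<le> x1" "x1 \<le> x" "x \<le> x2" "x2 \<le> B"
    "x1 = A \<or> x1 < x" "x2 = B \<or> x < x2" "x1 + 4 \<le> s" "s + 4 \<le> x2" "x2 \<le> x1 + 60"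
    using slotD(1-10)[OF X] by simp_all
  have Y': "t mod 20 = 10" "\<bar>t\<bar> \<le> int m - 4" "C \<le> y1" "y1 \<le> y" "y \<le> y2" "y2 \<le> D"
    "y1 = C \<or> y1 < y" "y2 = D \<or> y < y2" "y1 + 4 \<le> t" "t + 4 \<le> y2" "y2 \<le> y1 + 60"
    using slotD(1-10)[OF Y] by simp_all
  have bounds: "-int m \<le> x1" "x2 \<le> int m" "-int m \<le> y1" "y2 \<le> int m"
    using A(1) C(1) X'(3,6) Y'(3,6) m' by auto
  have "verts t' \<inter> rect x1 x2 y1 y2 = {}" if "t' \<in> grid m" "t' \<noteq> (s, t)" for t'
  proof -
    have "fst t' \<noteq> s \<or> snd t' \<noteq> t" using that(2) by (metis prod.collapse)
    then have "(fst t' + 2 < x1 \<or> x2 < fst t') \<or> (snd t' + 2 < y1 \<or> y2 < snd t')"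
      using slotD(11)[OF X, of "fst t'"] slotD(11)[OF Y, of "snd t'"] that(1) by (auto simp: grid_def)
    then show ?thesis by (auto simp: verts_def rect_def)
  qed
  moreover have "(0, 0) \<notin> rect x1 x2 y1 y2"
    using choice X'(3,6) Y'(3,6) by (auto simp: rect_def)
  moreover have "rect x1 x2 y1 y2 \<inter> box_boundary (Suc m) = {}"
    using bounds by (auto simp: rect_def box_boundary_def)
  moreover have "a \<in> box_boundary (Suc m)"
    if ab: "adj (x, y) a" "adj (x, y) b" "a \<noteq> b" "a \<notin> rect x1 x2 y1 y2" "b \<notin> rect x1 x2 y1 y2" for a b
  proof -
    obtain a1 a2 b1 b2 where ab_eq: "a = (a1, a2)" "b = (b1, b2)" by (metis prod.exhaust)
    have a: "\<bar>x - a1\<bar> + \<bar>y - a2\<bar> = 1" "a1 < x1 \<or> x2 < a1 \<or> a2 < y1 \<or> y2 < a2"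
      and b: "\<bar>x - b1\<bar> + \<bar>y - b2\<bar> = 1" "b1 < x1 \<or> x2 < b1 \<or> b2 < y1 \<or> y2 < b2"
      and ne: "a1 \<noteq> b1 \<or> a2 \<noteq> b2"
      using ab unfolding ab_eq rect_def by auto
    have size: "x1 + 8 \<le> x2" "y1 + 8 \<le> y2" using X'(9,10) Y'(9,10) by linarith+
    from choice have "max \<bar>a1\<bar> \<bar>a2\<bar> = int m + 1"
    proof
      assume "\<bar>x\<bar> \<le> \<bar>y\<bar> \<and> A = - int m \<and> B = int m \<and> 0 \<notin> {C..D}"
      then show ?thesis
        using X'(7,8) by (intro outer_neighbour_on_target[OF _ xy(2) size bounds X'(4,5) Y'(4,5) _ _ a b ne]) auto
    next
      assume "\<bar>y\<bar> \<le> \<bar>x\<bar> \<and> C = - int m \<and> D = int m \<and> 0 \<notin> {A..B}"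
      \<comment> \<open>The same statement with the two coordinates exchanged.\<close>
      then have "max \<bar>a2\<bar> \<bar>a1\<bar> = int m + 1"
        using Y'(7,8) a b ne
        by (intro outer_neighbour_on_target[OF _ xy(1) size(2,1) bounds(3,4,1,2) Y'(4,5) X'(4,5), of a2 a1 b2 b1])
          (auto simp: add.commute)
      then show ?thesis by (simp add: max.commute)
    qed
    then show ?thesis by (simp add: ab_eq box_boundary_def)
  qed
  ultimately have "good_region (Suc m) (grid m) (x, y) x1 x2 y1 y2 (s, t)"
    unfolding good_region_def using X' Y' by (simp add: grid_def rect_def)
  moreover have "rect x1 x2 y1 y2 \<subseteq> rect (- int m) (int m) (- int m) (int m)"
    using bounds by (auto simp: rect_def)
  ultimately show ?thesis using X'(11) Y'(11) by blast
qed

lemma good_region_exists: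
  assumes m: "61 \<le> m" and u: "\<bar>fst u\<bar> \<le> int m" "\<bar>snd u\<bar> \<le> int m" "u \<noteq> (0, 0)"
  shows "\<exists>x1 x2 y1 y2 t. good_region (Suc m) (grid m) u x1 x2 y1 y2 t \<and> x2 \<le> x1 + 60 \<and> y2 \<le> y1 + 60 \<and>
    rect x1 x2 y1 y2 \<subseteq> rect (- int m) (int m) (- int m) (int m)"
proof -
  obtain x y where u_eq: "u = (x, y)" by (cases u)
  have xy: "\<bar>x\<bar> \<le> int m" "\<bar>y\<bar> \<le> int m" "(x, y) \<noteq> (0, 0)" using u by (auto simp: u_eq)
  then consider "\<bar>x\<bar> \<le> \<bar>y\<bar>" "1 \<le> y" | "\<bar>x\<bar> \<le> \<bar>y\<bar>" "y \<le> -1" | "\<bar>y\<bar> \<le> \<bar>x\<bar>" "1 \<le> x" | "\<bar>y\<bar> \<le> \<bar>x\<bar>" "x \<le> -1"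
    by force
  then show ?thesis unfolding u_eq
  proof cases
    case 1
    then show "\<exists>x1 x2 y1 y2 t. good_region (Suc m) (grid m) (x, y) x1 x2 y1 y2 t \<and> x2 \<le> x1 + 60 \<and> y2 \<le> y1 + 60 \<and>
    rect x1 x2 y1 y2 \<subseteq> rect (- int m) (int m) (- int m) (int m)"
      using xy by (intro good_region_aux[OF m xy, of "- int m" "int m" 1 "int m"]) auto
  next
    case 2
    then show "\<exists>x1 x2 y1 y2 t. good_region (Suc m) (grid m) (x, y) x1 x2 y1 y2 t \<and> x2 \<le> x1 + 60 \<and> y2 \<le> y1 + 60 \<and>
    rect x1 x2 y1 y2 \<subseteq> rect (- int m) (int m) (- int m) (int m)"
      using xy by (intro good_region_aux[OF m xy, of "- int m" "int m" "- int m" "-1"]) auto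
  next
    case 3
    then show "\<exists>x1 x2 y1 y2 t. good_region (Suc m) (grid m) (x, y) x1 x2 y1 y2 t \<and> x2 \<le> x1 + 60 \<and> y2 \<le> y1 + 60 \<and>
    rect x1 x2 y1 y2 \<subseteq> rect (- int m) (int m) (- int m) (int m)"
      using xy by (intro good_region_aux[OF m xy, of 1 "int m" "- int m" "int m"]) auto
  next
    case 4
    then show "\<exists>x1 x2 y1 y2 t. good_region (Suc m) (grid m) (x, y) x1 x2 y1 y2 t \<and> x2 \<le> x1 + 60 \<and> y2 \<le> y1 + 60 \<and>
    rect x1 x2 y1 y2 \<subseteq> rect (- int m) (int m) (- int m) (int m)"
      using xy by (intro good_region_aux[OF m xy, of "- int m" "-1" "- int m" "int m"]) auto
  qed
qed

section \<open>Strict monotonicity\<close>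

lemma edges_meeting_finite:
  assumes "finite W"
  shows "finite {e \<in> lattice_edges. e \<inter> W \<noteq> {}}" and "card {e \<in> lattice_edges. e \<inter> W \<noteq> {}} \<le> 4 * card W"
proof -
  let ?D = "{(1, 0), (-1, 0), (0, 1), (0, -1)} :: vertex set"
  have sub: "{e \<in> lattice_edges. e \<inter> W \<noteq> {}} \<subseteq> (\<lambda>(w, d). {w, w + d}) ` (W \<times> ?D)"
  proof
    fix e assume "e \<in> {e \<in> lattice_edges. e \<inter> W \<noteq> {}}"
    then obtain u v where e: "e = {u, v}" "u \<in> W" "adj u v"
      unfolding lattice_edges_def adj_def
      by (smt (verit) Int_emptyI abs_minus_commute insert_commute insertE mem_Collect_eq singletonD)
    have "v - u \<in> ?D"
    proof -
      obtain a b c d where uv: "u = (a, b)" "v = (c, d)" by (metis prod.exhaust)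
      have "\<bar>a - c\<bar> + \<bar>b - d\<bar> = 1" using e(3) by (simp add: uv)
      then have "c - a = 1 \<and> d - b = 0 \<or> c - a = -1 \<and> d - b = 0 \<or> c - a = 0 \<and> d - b = 1 \<or> c - a = 0 \<and> d - b = -1"
        by arith
      then show ?thesis by (auto simp: uv)
    qed
    then have "(u, v - u) \<in> W \<times> ?D" using e(2) by blast
    moreover have "e = (\<lambda>(w, d). {w, w + d}) (u, v - u)" using e(1) by simp
    ultimately show "e \<in> (\<lambda>(w, d). {w, w + d}) ` (W \<times> ?D)" by blast
  qed
  show "finite {e \<in> lattice_edges. e \<inter> W \<noteq> {}}"
    by (rule finite_subset[OF sub]) (use assms in auto)
  have "card {e \<in> lattice_edges. e \<inter> W \<noteq> {}} \<le> card ((\<lambda>(w, d). {w, w + d}) ` (W \<times> ?D))"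
    by (rule card_mono[OF _ sub]) (use assms in auto)
  also have "\<dots> \<le> card (W \<times> ?D)" by (rule card_image_le) (use assms in auto)
  also have "\<dots> = 4 * card W" by (simp add: card_cartesian_product)
  finally show "card {e \<in> lattice_edges. e \<inter> W \<noteq> {}} \<le> 4 * card W" .
qed

lemma finite_rect [simp]: "finite (rect a b c d)"
  by (simp add: rect_def)

lemma card_rect_le:
  assumes "b \<le> a + int k" "d \<le> c + int k"
  shows "card (rect a b c d) \<le> (k + 1) * (k + 1)"
proof -
  have "nat (b - a + 1) \<le> k + 1" "nat (d - c + 1) \<le> k + 1" using assms by linarith+
  then have "nat (b - a + 1) * nat (d - c + 1) \<le> (k + 1) * (k + 1)" by (rule mult_le_mono)
  then show ?thesis by (simp add: rect_def card_cartesian_product)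
qed

abbreviation square :: "nat \<Rightarrow> vertex set" where
  "square m \<equiv> rect (- int m) (int m) (- int m) (int m)"

definition square_edges :: "nat \<Rightarrow> edge set" where
  "square_edges m = {e \<in> lattice_edges. e \<inter> square m \<noteq> {}}"

lemma finite_square_edges: "finite (square_edges m)"
  unfolding square_edges_def by (intro edges_meeting_finite) simp

lemma finite_grid: "finite (grid m)"
proof (rule finite_subset)
  show "grid m \<subseteq> square m" by (auto simp: grid_def rect_def mem_Times_iff)
qed simp

lemma stays_in_square:
  assumes "successively adj p" "p \<noteq> []" "hd p = (0, 0)" "set p \<inter> box_boundary (Suc m) = {}"
  shows "set p \<subseteq> square m"
  using assms
proof (induction p rule: rev_induct)
  case (snoc x p)
  show ?case
  proof (cases "p = []")
    case True
    then show ?thesis using snoc.prems by (simp add: rect_def)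
  next
    case False
    with snoc.prems have p: "set p \<subseteq> square m" "adj (last p) x" "x \<notin> box_boundary (Suc m)"
      using snoc.IH by (auto simp: successively_append_iff)
    have "last p \<in> square m" using p(1) False by auto
    obtain a b c d where e: "last p = (a, b)" "x = (c, d)" by (metis prod.exhaust)
    have ab: "\<bar>a\<bar> \<le> int m" "\<bar>b\<bar> \<le> int m" using \<open>last p \<in> square m\<close> by (auto simp: e rect_def)
    have "\<bar>a - c\<bar> + \<bar>b - d\<bar> = 1" using p(2) by (simp add: e)
    then have "\<bar>c\<bar> \<le> int m + 1" "\<bar>d\<bar> \<le> int m + 1" using ab by arith+
    moreover have "max \<bar>c\<bar> \<bar>d\<bar> \<noteq> int m + 1" using p(3) by (simp add: e box_boundary_def)
    ultimately have "\<bar>c\<bar> \<le> int m \<and> \<bar>d\<bar> \<le> int m" by linarith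
    then show ?thesis using p(1) by (auto simp: e rect_def)
  qed
qed simp

section \<open>Percolation events and crossings\<close>

text \<open>Keeping only grid translates of the first pattern weakens the constraint, and cutting
  the path at its first visit to the target can only remove patterns from it.\<close>

lemma without_forbidden_imp_crossing:
  assumes "\<omega> \<in> origin_to_boundary_without_forbidden q (Suc m)"
  shows "\<exists>p. crossing (Suc m) (grid m) (Inl ` {e \<in> square_edges m. \<omega> e}) p"
proof -
  obtain p where p: "open_path \<omega> p" "hd p = (0, 0)" "last p \<in> box_boundary (Suc m)"
    and ok: "\<And>\<pi>. \<pi> \<in> forbidden_patterns \<Longrightarrow> \<not> uses_pattern \<omega> p \<pi>"
    using assms unfolding origin_to_boundary_without_forbidden_def by blast
  have "p \<noteq> []" using p(1) by (simp add: open_path_def)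
  then have "\<exists>z\<in>set p. z \<in> box_boundary (Suc m)" using p(3) by (meson last_in_set)
  then obtain ys z zs where split: "p = ys @ z # zs" "z \<in> box_boundary (Suc m)" "\<forall>y\<in>set ys. y \<notin> box_boundary (Suc m)"
    using split_list_first_prop[of p "\<lambda>v. v \<in> box_boundary (Suc m)"] by blast
  define p' where "p' = ys @ [z]"
  have "path_edges p = path_edges p' \<union> path_edges (z # zs)"
    using path_edges_append_last[of p' zs] by (simp add: p'_def split(1))
  then have sub: "path_edges p' \<subseteq> path_edges p" by blast
  have ys: "ys \<noteq> []"
    using p(2) split by (cases ys) (auto simp: box_boundary_def)
  have op: "path_edges p \<subseteq> lattice_edges" "\<And>e. e \<in> path_edges p \<Longrightarrow> \<omega> e"
    using p(1) by (auto simp: open_path_def)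
  have "successively adj (ys @ [z])"
    using sub op(1) unfolding p'_def path_edges_lattice_iff[symmetric] by blast
  then have "successively adj ys" by (simp add: successively_append_iff)
  then have ysq: "set ys \<subseteq> square m"
    using stays_in_square[of ys m] ys p(2) split by (auto simp: hd_append)
  \<comment> \<open>The final edge leaves the square, but its first endpoint is in \<open>ys\<close>
    and hence inside. This is why \<open>square_edges\<close> collects the edges that meet the
    square rather than those contained in it.\<close>
  have in_sq: "e \<in> square_edges m \<and> \<omega> e" if "e \<in> path_edges p'" for e
  proof -
    obtain i where i: "e = {p' ! i, p' ! Suc i}" "Suc i < length p'"
      using \<open>e \<in> path_edges p'\<close> by (auto simp: path_edges_def)
    then have "p' ! i = ys ! i" "i < length ys" by (auto simp: p'_def nth_append)
    then have "p' ! i \<in> square m" using ysq nth_mem by fastforce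
    then show ?thesis using i(1) that sub op by (auto simp: square_edges_def)
  qed
  have "crossing (Suc m) (grid m) (Inl ` {e \<in> square_edges m. \<omega> e}) p'"
    unfolding crossing_def
  proof (intro conjI ballI impI)
    show "p' \<noteq> []" by (simp add: p'_def)
    show "distinct p'" using p(1) split(1) by (auto simp: open_path_def p'_def)
    show "hd p' = (0, 0)" using p(2) split(1) ys by (simp add: p'_def)
    show "last p' \<in> box_boundary (Suc m)" using split by (simp add: p'_def)
    show "set (butlast p') \<inter> box_boundary (Suc m) = {}" using split by (auto simp: p'_def)
    show "e \<in> lattice_edges" if "e \<in> path_edges p'" for e using that sub op by blast
    show "Inl e \<in> Inl ` {e \<in> square_edges m. \<omega> e}" if "e \<in> path_edges p'" for e
      using in_sq[OF that] by blast
    fix t assume t: "t \<in> grid m" "pattern_open t \<subseteq> path_edges p'"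
    let ?\<pi> = "map_pattern (\<lambda>z. z + t) first_pattern"
    have "?\<pi> \<in> forbidden_patterns" unfolding forbidden_patterns_def by blast
    then have "\<not> uses_pattern \<omega> p ?\<pi>" by (rule ok)
    moreover have "pattern_open t \<subseteq> path_edges p" using t(2) sub by blast
    ultimately obtain e where e: "e \<in> pattern_closed t" "\<omega> e"
      using op(2) unfolding uses_pattern_def occurs_def pattern_open_def pattern_closed_def by blast
    have "verts t \<subseteq> square m" using t(1) by (auto simp: grid_def verts_def rect_def)
    moreover have "e \<subseteq> verts t" using pattern_edge_verts[of e t] e(1) by blast
    moreover have "e \<noteq> {}" using e(1) by (cases t) (auto simp: pattern_closed_eq)
    ultimately have "e \<in> square_edges m" using pattern_closed_lattice e(1) unfolding square_edges_def by blast
    then show "Inr t \<in> Inl ` {e \<in> square_edges m. \<omega> e} \<or> (\<exists>e\<in>pattern_closed t. Inl e \<in> Inl ` {e \<in> square_edges m. \<omega> e})"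
      using e by blast
  qed
  then show ?thesis by blast
qed

lemma crossing_imp_origin_to_boundary:
  assumes "crossing n X (Inl ` {e \<in> E. \<omega> e}) p" "\<omega> \<in> space (percolation q)"
  shows "\<omega> \<in> origin_to_boundary q n"
  using assms unfolding crossing_def origin_to_boundary_def open_path_def by blast

lemma prob_space_percolation: "prob_space (percolation q)"
  unfolding percolation_def by (intro prob_space_PiM prob_space_measure_pmf)

text \<open>The constants: a region has at most \<open>14884 = 4 * 61\<^sup>2\<close> edges, and a grid pattern
  serves at most \<open>58564 = 4 * 121\<^sup>2\<close> edges.\<close>

definition drop_step :: real where
  "drop_step = 1 / 58564 * (1 / 8) ^ 14884"

lemma drop_step: "0 < drop_step" "drop_step \<le> 1 / 4"
proof -
  show "0 < drop_step" unfolding drop_step_def by (intro mult_pos_pos zero_less_power) simp_all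
  have "(1 / 8 :: real) ^ 14884 \<le> 1" by (intro power_le_one) simp_all
  then show "drop_step \<le> 1 / 4" unfolding drop_step_def by linarith
qed

section \<open>Trading edge density for switch density\<close>

text \<open>\<open>D\<close> holds the edges lowered so far, and each of them has added 1/58564 to
  the switch at \<open>loc e\<close>. For empty \<open>D\<close> every switch has probability 0, so
  all grid patterns are forbidden.\<close>

definition params :: "(edge \<Rightarrow> vertex) \<Rightarrow> edge set \<Rightarrow> edge + vertex \<Rightarrow> real" where
  "params loc D i = (case i of Inl e \<Rightarrow> if e \<in> D then 1 / 2 - drop_step else 1 / 2
     | Inr t \<Rightarrow> card {e \<in> D. loc e = t} / 58564)"

lemma params_simps [simp]:
  "params loc D (Inl e) = (if e \<in> D then 1 / 2 - drop_step else 1 / 2)"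
  "params loc D (Inr t) = card {e \<in> D. loc e = t} / 58564"
  by (simp_all add: params_def)

text \<open>Each edge is exchanged against the switch of its own region. A switch serves at most
  58564 edges, so the accumulated probabilities stay at most 1 however large \<open>m\<close>
  is.\<close>

lemma lower_edges:
  fixes m :: nat
  defines "I \<equiv> Inl ` square_edges m \<union> Inr ` grid m"
  defines "A \<equiv> \<lambda>S. \<exists>p. crossing (Suc m) (grid m) S p"
  assumes m: "61 \<le> m"
  shows "\<exists>loc. (\<forall>i\<in>I. 0 \<le> params loc (square_edges m) i \<and> params loc (square_edges m) i \<le> 1) \<and>
     bern_prob I (params loc {}) A \<le> bern_prob I (params loc (square_edges m)) A"
proof -
  let ?E = "square_edges m"
  have finI: "finite I" unfolding I_def using finite_square_edges finite_grid by blast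
  have "\<exists>u x1 x2 y1 y2 t. u \<in> e \<and> good_region (Suc m) (grid m) u x1 x2 y1 y2 t \<and>
      x2 \<le> x1 + 60 \<and> y2 \<le> y1 + 60 \<and> rect x1 x2 y1 y2 \<subseteq> square m" if e: "e \<in> ?E" for e
  proof -
    \<comment> \<open>An edge at the origin is treated through its other endpoint, since no region
      contains the origin.\<close>
    have "\<exists>u\<in>e. u \<in> square m \<and> u \<noteq> (0, 0)"
    proof (rule ccontr)
      assume no: "\<not> ?thesis"
      from e obtain a b where ab: "e = {a, b}" "adj a b" "a \<in> square m"
        unfolding square_edges_def lattice_edges_def adj_def
        by (smt (verit) Int_emptyI abs_minus_commute insert_commute insertE mem_Collect_eq singletonD)
      with no have a: "a = (0, 0)" by blast
      obtain c d where b: "b = (c, d)" by (cases b)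
      have "\<bar>c\<bar> + \<bar>d\<bar> = 1" using ab(2) by (simp add: a b)
      then have "\<bar>c\<bar> \<le> int m" "\<bar>d\<bar> \<le> int m" "(c, d) \<noteq> (0, 0)" using m by auto
      then show False using no ab(1) by (auto simp: b rect_def)
    qed
    then obtain u where u: "u \<in> e" "u \<in> square m" "u \<noteq> (0, 0)" by blast
    then have "\<bar>fst u\<bar> \<le> int m" "\<bar>snd u\<bar> \<le> int m" by (auto simp: rect_def)
    from good_region_exists[OF m this u(3)] u(1) show ?thesis by blast
  qed
  then obtain u x1 x2 y1 y2 loc where *: "\<And>e. e \<in> ?E \<Longrightarrow> u e \<in> e \<and>
      good_region (Suc m) (grid m) (u e) (x1 e) (x2 e) (y1 e) (y2 e) (loc e) \<and>
      x2 e \<le> x1 e + 60 \<and> y2 e \<le> y1 e + 60 \<and> rect (x1 e) (x2 e) (y1 e) (y2 e) \<subseteq> square m"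
    by metis
  have few: "card {e \<in> ?E. loc e = t} \<le> 58564" for t
  proof -
    \<comment> \<open>A region contains both \<open>u e\<close> and \<open>loc e\<close> and its
      sides are at most 60, so every edge served by \<open>t\<close> meets this block of 121 by 121
      vertices.\<close>
    let ?W = "rect (fst t - 60) (fst t + 60) (snd t - 60) (snd t + 60)"
    have "u e \<in> ?W" if "e \<in> ?E" "loc e = t" for e
      using *[OF that(1)] that(2) unfolding good_region_def rect_def mem_Times_iff by auto
    then have "{e \<in> ?E. loc e = t} \<subseteq> {e \<in> lattice_edges. e \<inter> ?W \<noteq> {}}"
      using * unfolding square_edges_def by blast
    then have "card {e \<in> ?E. loc e = t} \<le> card {e \<in> lattice_edges. e \<inter> ?W \<noteq> {}}"
      by (intro card_mono edges_meeting_finite) simp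
    also have "\<dots> \<le> 4 * card ?W" by (intro edges_meeting_finite) simp
    also have "card ?W \<le> (120 + 1) * (120 + 1)" by (intro card_rect_le) simp_all
    finally show ?thesis by simp
  qed
  have few': "card {e \<in> D. loc e = t} \<le> 58564" if "D \<subseteq> ?E" for D t
    using card_mono[of "{e \<in> ?E. loc e = t}" "{e \<in> D. loc e = t}"] few[of t] that finite_square_edges
    by fastforce
  have params01: "0 \<le> params loc D i \<and> params loc D i \<le> 1" if "D \<subseteq> ?E" for D i
    using few'[OF that] drop_step by (cases i) (auto simp: divide_le_eq)
  have "bern_prob I (params loc {}) A \<le> bern_prob I (params loc D) A" if "finite D" "D \<subseteq> ?E" for D
    using that
  proof (induction D rule: finite_induct)
    case (insert e D)
    then have e: "e \<in> ?E" and D: "D \<subseteq> ?E" by auto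
    note reg = *[OF e]
    let ?V = "rect (x1 e) (x2 e) (y1 e) (y2 e)"
    have GI: "touching ?V \<subseteq> I"
      using reg unfolding touching_def I_def square_edges_def by blast
    have cardG: "card (touching ?V) \<le> 14884"
    proof -
      have "card (touching ?V) = card {e \<in> lattice_edges. e \<inter> ?V \<noteq> {}}"
        unfolding touching_def by (intro card_image) simp
      also have "\<dots> \<le> 4 * card ?V" by (intro edges_meeting_finite) simp
      also have "card ?V \<le> (60 + 1) * (60 + 1)" using reg by (intro card_rect_le) simp_all
      finally show ?thesis by simp
    qed
    have upd: "params loc (insert e D) =
        (params loc D)(Inr (loc e) := params loc D (Inr (loc e)) + 1 / 58564,
          Inl e := params loc D (Inl e) - drop_step)"
    proof
      fix i show "params loc (insert e D) i =
        ((params loc D)(Inr (loc e) := params loc D (Inr (loc e)) + 1 / 58564,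
          Inl e := params loc D (Inl e) - drop_step)) i"
      proof (cases i)
        case (Inl e')
        then show ?thesis using insert.hyps by simp
      next
        case (Inr t)
        have "{e' \<in> insert e D. loc e' = t} =
          (if t = loc e then insert e {e' \<in> D. loc e' = t} else {e' \<in> D. loc e' = t})" by auto
        then show ?thesis using Inr insert.hyps by (simp add: add_divide_distrib)
      qed
    qed
    have "bern_prob I (params loc D) A \<le> bern_prob I (params loc (insert e D)) A"
      unfolding upd
    proof (rule bern_prob_exchange[where G = "touching ?V" and M = 14884 and \<kappa> = "1 / 4"])
      show "finite I" by (rule finI)
      show "Inl e \<in> I" using e by (simp add: I_def)
      show "Inr (loc e) \<in> I" using reg by (simp add: I_def good_region_def)
      show "Inl e \<noteq> Inr (loc e)" by simp
      show "touching ?V \<subseteq> I" by (rule GI)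
      show "Inr (loc e) \<notin> touching ?V" by (auto simp: touching_def)
      show "card (touching ?V) \<le> 14884" by (rule cardG)
      show "A T" if "S \<subseteq> T" "A S" for S T
        using that crossing_mono unfolding A_def by blast
      show "0 \<le> params loc D i \<and> params loc D i \<le> 1" for i by (rule params01[OF D])
      \<comment> \<open>\<open>touching\<close> contains edges only, so the switches of probability
        0 do no harm.\<close>
      show "1 / 4 \<le> params loc D g \<and> params loc D g \<le> 1 - 1 / 4" if "g \<in> touching ?V" for g
        using that drop_step by (auto simp: touching_def)
      have "card {e' \<in> insert e D. loc e' = loc e} \<le> 58564"
        using few'[of "insert e D"] insert.prems by blast
      moreover have "params loc D (Inr (loc e)) + 1 / 58564 = card {e' \<in> insert e D. loc e' = loc e} / 58564"
        using fun_cong[OF upd, of "Inr (loc e)"] by simp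
      ultimately show "params loc D (Inr (loc e)) + 1 / 58564 \<le> 1" by simp
      show "drop_step \<le> 1 / 58564 * (1 / 4 / 2) ^ 14884" unfolding drop_step_def by simp
      show "0 \<le> drop_step" using drop_step by simp
      fix S assume S: "S \<subseteq> I" "pivotal (Inl e) A S"
      obtain T where T: "T \<subseteq> S \<union> touching ?V" "T - touching ?V = S - touching ?V" "pivotal (Inr (loc e)) A T"
        using surgery[of "Suc m" "grid m" "u e" "x1 e" "x2 e" "y1 e" "y2 e" "loc e" e S] reg e S(2)
        unfolding A_def square_edges_def by blast
      have "T \<subseteq> I" using T(1) S(1) GI by (meson Un_least subset_trans)
      with T(2,3) show "\<exists>T\<subseteq>I. T - touching ?V = S - touching ?V \<and> pivotal (Inr (loc e)) A T"
        by (intro exI[of _ T] conjI)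
    qed (use zero_less_one in simp_all)
    with insert show ?case by simp
  qed simp
  then show ?thesis using params01[of ?E] finite_square_edges by blast
qed

theorem theorem6p1:
  "\<exists>\<epsilon>::real. 0 < \<epsilon> \<and> \<epsilon> \<le> 1/2 \<and>
     (\<exists>N::nat. \<forall>n\<ge>N.
        measure (percolation (1/2)) (origin_to_boundary_without_forbidden (1/2) n)
        \<le> measure (percolation (1/2 - \<epsilon>)) (origin_to_boundary (1/2 - \<epsilon>) n))"
proof (intro exI[of _ drop_step] exI[of _ 62] conjI allI impI)
  show "0 < drop_step" "drop_step \<le> 1 / 2" using drop_step by simp_all
  fix n :: nat assume n: "62 \<le> n"
  \<comment> \<open>The target is the layer just outside the square of radius \<open>m\<close>, and
    regions exist once \<open>m\<close> is at least 61.\<close>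
  then obtain m where nm: "n = Suc m" "61 \<le> m" by (cases n) auto
  let ?E = "square_edges m" and ?q = "1 / 2 - drop_step"
  let ?I = "Inl ` ?E \<union> Inr ` grid m :: (edge + vertex) set"
  define A where "A = (\<lambda>S. \<exists>p. crossing (Suc m) (grid m) S p)"
  define B where "B = (\<lambda>S. \<exists>p. crossing (Suc m) {} S p)"
  have fin: "finite (Inl ` ?E)" "finite (Inr ` grid m)" using finite_square_edges finite_grid by auto
  have disj: "Inl ` ?E \<inter> Inr ` grid m = {}" by auto
  have E: "finite ?E" "?E \<subseteq> lattice_edges" using finite_square_edges by (auto simp: square_edges_def)
  obtain loc where loc: "\<And>i. i \<in> ?I \<Longrightarrow> 0 \<le> params loc ?E i \<and> params loc ?E i \<le> 1"
    and lower: "bern_prob ?I (params loc {}) A \<le> bern_prob ?I (params loc ?E) A"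
    using lower_edges[OF nm(2)] unfolding A_def by blast
  define C where "C = {\<omega> \<in> space (percolation (1 / 2)). A (Inl ` {e \<in> ?E. \<omega> e})}"
  have C: "C \<in> sets (percolation (1 / 2))"
    "measure (percolation (1 / 2)) C = bern_prob ?E (\<lambda>_. 1 / 2) (\<lambda>S. A (Inl ` S))"
    using measure_percolation_cylinder[OF _ _ E, of "1 / 2" C "\<lambda>S. A (Inl ` S)"] by (auto simp: C_def)
  define D where "D = {\<omega> \<in> space (percolation ?q). B (Inl ` {e \<in> ?E. \<omega> e})}"
  have D: "measure (percolation ?q) D = bern_prob ?E (\<lambda>_. ?q) (\<lambda>S. B (Inl ` S))"
    using measure_percolation_cylinder(2)[OF _ _ E, of ?q D "\<lambda>S. B (Inl ` S)"] drop_step by (auto simp: D_def)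
  interpret half: prob_space "percolation (1 / 2)" by (rule prob_space_percolation)
  interpret low: prob_space "percolation ?q" by (rule prob_space_percolation)
  have "origin_to_boundary_without_forbidden (1 / 2) n \<subseteq> C"
    using without_forbidden_imp_crossing[of _ "1 / 2" m] unfolding C_def A_def nm(1)
    by (auto simp: origin_to_boundary_without_forbidden_def)
  then have "measure (percolation (1 / 2)) (origin_to_boundary_without_forbidden (1 / 2) n)
      \<le> bern_prob ?E (\<lambda>_. 1 / 2) (\<lambda>S. A (Inl ` S))"
    unfolding C(2)[symmetric] by (rule half.finite_measure_mono) (rule C(1))
  also have "\<dots> = bern_prob (Inl ` ?E) (params loc {}) A"
    unfolding bern_prob_image[OF inj_Inl] by (intro bern_prob_cong) simp_all
  \<comment> \<open>Before any edge is lowered all switches are off almost surely, so adjoining them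
    changes nothing.\<close>
  also have "\<dots> = bern_prob ?I (params loc {}) A"
    by (rule bern_prob_Un_zero[symmetric]) (use fin disj in auto)
  also have "\<dots> \<le> bern_prob ?I (params loc ?E) A" by (rule lower)
  \<comment> \<open>Dropping the pattern constraint enlarges the event and removes its dependence on
    the switches, whatever probabilities they have acquired.\<close>
  also have "\<dots> \<le> bern_prob ?I (params loc ?E) B"
    by (rule bern_prob_mono) (use loc in \<open>auto simp: A_def B_def crossing_def\<close>)
  also have "\<dots> = bern_prob (Inl ` ?E) (params loc ?E) B"
  proof (rule bern_prob_Un_irrelevant)
    fix S :: "(edge + vertex) set"
    have "crossing (Suc m) {} S p = crossing (Suc m) {} (S - Inr ` grid m) p" for p
      unfolding crossing_def by auto
    then show "B S = B (S - Inr ` grid m)" unfolding B_def by blast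
  qed (use fin disj in auto)
  also have "\<dots> = bern_prob ?E (\<lambda>_. ?q) (\<lambda>S. B (Inl ` S))"
    unfolding bern_prob_image[OF inj_Inl] by (intro bern_prob_cong) simp_all
  also have "\<dots> \<le> measure (percolation ?q) (origin_to_boundary ?q n)"
    unfolding D[symmetric]
  proof (rule low.finite_measure_mono)
    show "D \<subseteq> origin_to_boundary ?q n"
      unfolding D_def B_def nm(1) using crossing_imp_origin_to_boundary by blast
  qed (rule origin_to_boundary_sets)
  finally show "measure (percolation (1/2)) (origin_to_boundary_without_forbidden (1/2) n)
      \<le> measure (percolation ?q) (origin_to_boundary ?q n)" .
qed

end
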